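(* Let $n\ge1$ be an integer, let $\sigma$ be a real number with $0<\sigma<n/2$, and let $\Sigma\subset\mathbb{R}^n$ be a nonempty closed set with $\mathcal{L}^n(\Sigma)=0$. Let $h\in C^1(B_2)$ be a positive function and let $u\in L^{\frac{n+2\sigma}{n-2\sigma}}(B_2)\cap C(B_2\setminus\Sigma)$ be a positive solution of $$u(x)=\int_{B_2}\frac{u(y)^{\frac{n+2\sigma}{n-2\sigma}}}{|x-y|^{n-2\sigma}}\,dy+h(x),\qquad x\in B_2\setminus\Sigma.$$ Then there exists a constant $C>0$ such that $$u(x)\le C\,[d(x,\Sigma)]^{-\frac{n-2\sigma}{2}}\quad\text{for all }x\in B_1\setminus\Sigma,$$ where $d(x,\Sigma)$ is the distance between $x$ and $\Sigma$.
   Context: $B_r$ denotes the open ball of radius $r$ centered at the origin in $\mathbb{R}^n$. $\mathcal{L}^n$ is the $n$-dimensional Lebesgue measure. $\Sigma$ is allowed to intersect $\partial B_2$. *)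

theory Defs
  imports "HOL-Analysis.Analysis"
begin

text \<open>Meant for open \<open>S\<close>, where it is the usual class of continuously differentiable functions.\<close>

definition C1_on :: "'a::euclidean_space set \<Rightarrow> ('a \<Rightarrow> real) \<Rightarrow> bool" where
  "C1_on S h \<longleftrightarrow>
     (\<exists>h' :: 'a \<Rightarrow> 'a \<Rightarrow>\<^sub>L real.
        (\<forall>x\<in>S. (h has_derivative blinfun_apply (h' x)) (at x)) \<and> continuous_on S h')"

definition Lp_on :: "real \<Rightarrow> 'a::euclidean_space set \<Rightarrow> ('a \<Rightarrow> real) \<Rightarrow> bool" where
  "Lp_on p S u \<longleftrightarrow>
     set_borel_measurable lebesgue S u \<and> set_integrable lebesgue S (\<lambda>x. \<bar>u x\<bar> powr p)"

text \<open>
  The integrability clause says that the integral, which is that of a function nonnegative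
  almost everywhere when \<open>u\<close> is positive off a null set, is finite. Without it, the convention
  that the integral of a non-integrable function is \<open>0\<close> would admit spurious solutions.
  At \<open>y = x\<close> the quotient is \<open>0\<close> by convention, which does not affect the integral.
\<close>

definition solves_integral_eq ::
    "real \<Rightarrow> (real ^ 'n \<Rightarrow> real) \<Rightarrow> (real ^ 'n) set \<Rightarrow> (real ^ 'n \<Rightarrow> real) \<Rightarrow> bool" where
  "solves_integral_eq \<sigma> h \<Sigma> u \<longleftrightarrow>
     (let n = real CARD('n);
          F = (\<lambda>x y. u y powr ((n + 2 * \<sigma>) / (n - 2 * \<sigma>)) / norm (x - y) powr (n - 2 * \<sigma>))
      in \<forall>x \<in> ball 0 2 - \<Sigma>.
           set_integrable lebesgue (ball 0 2) (F x) \<and>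
           u x = (LINT y:ball 0 2|lebesgue. F x y) + h x)"

end

(* Suppose u concentrates: after a doubling argument there are points z, far from the singular set
   on the scale M^(-2/gamma), M = u z, with u bounded by a multiple of M on a large multiple of that
   scale. The moving sphere method then shows that u dominates its Kelvin transforms
   (l/|y-x|)^gamma u(x + l^2 (y-x)/|y-x|^2) for all spheres of radius comparable to that scale.
   Choosing the sphere that interchanges y and z gives u >= 2^(-gamma/2) M on a ball of radius
   rho M^(-2/gamma) around z, and for rho large the integral equation at z is violated.

   The spheres are moved with an integral form of the maximum principle: where a Kelvin transform
   exceeds u, the difference is bounded by a convolution over that set alone, so the set is empty
   as soon as its measure is small. No regularity of u beyond continuity and no passage to a limit
   profile is needed. *)
theory Submission
  imports Defs
begin

text \<open>The obstacle is that the equation lives on B_2 only. The inverted density is spread over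
  the whole exterior of the sphere, while that of u stops at the boundary of B_2, so outside B_2 the
  difference has the wrong sign. The equation at the center of the sphere bounds the inverted mass
  by a multiple of 1/M at the concentration scale, whereas u has a fixed positive lower bound and
  hence a fixed surplus of mass in the annulus 1/4 < |y - x| < 1/2. The kernel differences there and
  outside B_2 both vanish when z approaches the sphere, but they stay comparable uniformly in z and
  the radius; this is why the surplus beats the loss for all spheres at once. The strictness of that
  inequality also replaces the strong maximum principle. The term h obeys its own Kelvin inequality
  at small distances because the growth of t^(\<gamma>/2) outweighs the variation of a positive C^1
  function.\<close>

section \<open>Inversion in a sphere\<close>

text \<open>At \<open>y = x\<close> division by zero makes the value \<open>x\<close>, although the
  center should correspond to infinity; this is why \<open>y \<noteq> x\<close> is assumed wherever
  the involution is used.\<close>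

definition inversion :: "'a::real_inner \<Rightarrow> real \<Rightarrow> 'a \<Rightarrow> 'a" where
  "inversion x r y = x + (r / norm (y - x))\<^sup>2 *\<^sub>R (y - x)"

lemma norm_inversion: "norm (inversion x r y - x) = r\<^sup>2 / norm (y - x)"
  by (simp add: inversion_def power_divide power2_eq_square)

lemma inversion_inversion:
  assumes "r > 0" "y \<noteq> x"
  shows "inversion x r (inversion x r y) = y"
proof -
  have "inversion x r (inversion x r y) = x + (r / (r\<^sup>2 / norm (y - x)))\<^sup>2 *\<^sub>R ((r / norm (y - x))\<^sup>2 *\<^sub>R (y - x))"
    by (subst inversion_def, subst norm_inversion) (simp add: inversion_def)
  also have "\<dots> = x + (y - x)"
    using assms by (simp add: field_simps power2_eq_square)
  finally show ?thesis by simp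
qed

lemma inversion_neq_center:
  assumes "r > 0" "y \<noteq> x"
  shows "inversion x r y \<noteq> x"
  using assms by (simp add: inversion_def)

text \<open>Expanding the square on the left with t |z - x|^2 = r^2 leaves a polynomial identity.
  The sign of the last summand decides whether the reflected, weighted kernel lies below the
  original one, so every kernel comparison below comes from here.\<close>

lemma norm_inversion_diff_sq:
  assumes "z \<noteq> x"
  shows "(norm (z - x))\<^sup>2 * (norm (inversion x r z - y))\<^sup>2 =
    r\<^sup>2 * (norm (z - y))\<^sup>2 + ((norm (z - x))\<^sup>2 - r\<^sup>2) * ((norm (y - x))\<^sup>2 - r\<^sup>2)"
proof -
  define a b where "a = z - x" and "b = y - x"
  define t where "t = (r / norm a)\<^sup>2"
  have t: "t * (a \<bullet> a) = r\<^sup>2"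
    using assms by (simp add: t_def a_def power_divide power2_norm_eq_inner)
  have 1: "inversion x r z - y = t *\<^sub>R a - b" and 2: "z - y = a - b"
    by (simp_all add: inversion_def a_def b_def t_def)
  have "(a \<bullet> a) * ((t *\<^sub>R a - b) \<bullet> (t *\<^sub>R a - b)) =
      r\<^sup>2 * ((a - b) \<bullet> (a - b)) + (a \<bullet> a - r\<^sup>2) * (b \<bullet> b - r\<^sup>2)"
    unfolding t[symmetric] by (simp add: inner_diff inner_commute algebra_simps)
  then show ?thesis
    unfolding power2_norm_eq_inner 1 2 a_def[symmetric] b_def[symmetric] .
qed

text \<open>The right-hand side of \<open>norm_inversion_diff_sq\<close> is symmetric in y and z, so
  the reflection can be moved from one argument of a kernel to the other.\<close>

lemma norm_inversion_commute:
  assumes "y \<noteq> x" "z \<noteq> x"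
  shows "norm (z - x) * norm (inversion x r z - y) = norm (y - x) * norm (inversion x r y - z)"
proof -
  have "(norm (z - x) * norm (inversion x r z - y))\<^sup>2 = (norm (y - x) * norm (inversion x r y - z))\<^sup>2"
    unfolding power_mult_distrib norm_inversion_diff_sq[OF assms(1)] norm_inversion_diff_sq[OF assms(2)]
    by (simp add: norm_minus_commute algebra_simps)
  then show ?thesis by (simp add: power2_eq_iff_nonneg)
qed

lemma borel_measurable_inversion [measurable]:
  "inversion x r \<in> borel_measurable (borel :: 'a::euclidean_space measure)"
  unfolding inversion_def by measurable

lemma inversion_image_outside:
  assumes "r > 0"
  shows "inversion x r ` (inversion x r -` A \<inter> {y. r < norm (y - x)}) = A \<inter> (ball x r - {x})"
proof (intro equalityI subsetI)
  fix z assume "z \<in> inversion x r ` (inversion x r -` A \<inter> {y. r < norm (y - x)})"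
  then obtain y where y: "z = inversion x r y" "z \<in> A" "r < norm (y - x)" by auto
  have "y \<noteq> x" using y(3) assms by auto
  moreover have "norm (z - x) < r"
    using y assms order.strict_trans[OF assms y(3)] mult_strict_left_mono[of r "norm (y - x)" r]
    by (simp add: norm_inversion power2_eq_square pos_divide_less_eq)
  ultimately show "z \<in> A \<inter> (ball x r - {x})"
    using inversion_neq_center[OF assms, of y x] y by (auto simp: dist_norm norm_minus_commute)
next
  fix z assume z: "z \<in> A \<inter> (ball x r - {x})"
  then have "norm (z - x) < r" "z \<noteq> x" by (auto simp: dist_norm norm_minus_commute)
  then have "r < norm (inversion x r z - x)"
    using assms mult_strict_left_mono[of "norm (z - x)" r r]
    by (simp add: norm_inversion power2_eq_square pos_less_divide_eq)
  then show "z \<in> inversion x r ` (inversion x r -` A \<inter> {y. r < norm (y - x)})"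
    using z inversion_inversion[OF assms, of z x] by (intro image_eqI[of _ _ "inversion x r z"]) auto
qed

section \<open>The Jacobian of the inversion and the change of variables\<close>

lemma has_derivative_inversion:
  fixes y :: "'a::real_inner"
  assumes "y \<noteq> x"
  shows "(inversion x r has_derivative
    (\<lambda>v. (r / norm (y - x))\<^sup>2 *\<^sub>R (v - (2 * ((y - x) \<bullet> v) / ((y - x) \<bullet> (y - x))) *\<^sub>R (y - x)))) (at y)"
proof -
  have eq: "inversion x r = (\<lambda>y. x + (r\<^sup>2 / ((y - x) \<bullet> (y - x))) *\<^sub>R (y - x))"
    by (auto simp: inversion_def power_divide power2_norm_eq_inner)
  define a where "a = y - x"
  have "((\<lambda>y. x + (r\<^sup>2 / ((y - x) \<bullet> (y - x))) *\<^sub>R (y - x)) has_derivative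
      (\<lambda>v. (r\<^sup>2 / (a \<bullet> a)) *\<^sub>R v + (- (r\<^sup>2 * (2 * (a \<bullet> v)) / ((a \<bullet> a) * (a \<bullet> a)))) *\<^sub>R a)) (at y)"
    unfolding a_def using assms by (auto intro!: derivative_eq_intros simp: inner_commute)
  then show ?thesis
    unfolding eq a_def[symmetric]
    by (rule has_derivative_eq_rhs)
       (simp add: scaleR_diff_right power_divide power2_norm_eq_inner mult_ac)
qed

lemma orthogonal_transformation_reflection:
  fixes a :: "'a::euclidean_space"
  assumes "a \<noteq> 0"
  shows "orthogonal_transformation (\<lambda>v. v - (2 * (a \<bullet> v) / (a \<bullet> a)) *\<^sub>R a)"
proof -
  have "linear (\<lambda>v. v - (2 * (a \<bullet> v) / (a \<bullet> a)) *\<^sub>R a)"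
    by (intro linearI) (auto simp: inner_simps algebra_simps add_divide_distrib)
  moreover have "(v - (2 * (a \<bullet> v) / (a \<bullet> a)) *\<^sub>R a) \<bullet> (w - (2 * (a \<bullet> w) / (a \<bullet> a)) *\<^sub>R a) = v \<bullet> w" for v w
    using assms by (simp add: inner_diff inner_commute algebra_simps)
  ultimately show ?thesis by (simp add: orthogonal_transformation_def)
qed

text \<open>The derivative of the inversion has this form with a = y - x and c = (r / |y - x|)^2: a
  dilation after the reflection in the hyperplane orthogonal to a.\<close>

lemma abs_det_scaled_reflection:
  fixes a :: "real ^ 'n"
  assumes "a \<noteq> 0"
  shows "\<bar>det (matrix (\<lambda>v. c *\<^sub>R (v - (2 * (a \<bullet> v) / (a \<bullet> a)) *\<^sub>R a)))\<bar> = \<bar>c\<bar> ^ CARD('n)"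
proof -
  let ?R = "\<lambda>v. v - (2 * (a \<bullet> v) / (a \<bullet> a)) *\<^sub>R a"
  have R: "orthogonal_transformation ?R" by (rule orthogonal_transformation_reflection[OF assms])
  then have "linear ?R" by (rule orthogonal_transformation_linear)
  then have "matrix ((*\<^sub>R) c \<circ> ?R) = matrix ((*\<^sub>R) c) ** matrix ?R"
    by (intro matrix_compose) auto
  then have "\<bar>det (matrix ((*\<^sub>R) c \<circ> ?R))\<bar> = \<bar>c\<bar> ^ CARD('n)"
    using R by (simp add: det_mul abs_mult power_abs)
  then show ?thesis by (simp add: o_def)
qed

text \<open>The density is the Jacobian determinant of the inversion on the exterior. An equality of
  measures yields both the integrability and the value of a transformed integral.\<close>

lemma distr_inversion_wellorder:
  fixes x :: "real ^ 'n::{finite,wellorder}"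
  assumes r: "r > 0"
  shows "distr (density lborel (\<lambda>y. indicator {y. r < norm (y - x)} y * ennreal ((r / norm (y - x)) ^ (2 * CARD('n)))))
           borel (inversion x r) = density lborel (indicator (ball x r))"
    (is "distr (density lborel ?J) borel _ = _")
proof (rule measure_eqI)
  fix A assume "A \<in> sets (distr (density lborel ?J) borel (inversion x r))"
  then have A[measurable]: "A \<in> sets borel" by simp
  define S where "S = inversion x r -` A \<inter> {y. r < norm (y - x)}"
  have V[measurable]: "inversion x r -` A \<in> sets borel"
    using measurable_sets[OF borel_measurable_inversion A] by simp
  then have S[measurable]: "S \<in> sets borel" unfolding S_def by simp
  have im: "inversion x r ` S = A \<inter> (ball x r - {x})"
    unfolding S_def by (rule inversion_image_outside[OF r])
  have Sx: "y \<noteq> x" if "y \<in> S" for y using that r by (auto simp: S_def)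
  \<comment> \<open>The images lie in the ball, so they have finite measure and the image formula
    applies although the exterior is unbounded.\<close>
  have lm: "inversion x r ` S \<in> lmeasurable"
    unfolding im by (intro bounded_set_imp_lmeasurable bounded_subset[OF bounded_ball, of _ x r]) auto
  have "((\<lambda>y. \<bar>det (matrix (\<lambda>v. (r / norm (y - x))\<^sup>2 *\<^sub>R (v - (2 * ((y - x) \<bullet> v) / ((y - x) \<bullet> (y - x))) *\<^sub>R (y - x))))\<bar>)
       has_integral measure lebesgue (inversion x r ` S)) S"
  proof (rule iffD1[OF has_measure_differentiable_image])
    show "inj_on (inversion x r) S"
      using Sx inversion_inversion[OF r] by (metis inj_on_inverseI)
    show "(inversion x r has_derivative (\<lambda>v. (r / norm (y - x))\<^sup>2 *\<^sub>R (v - (2 * ((y - x) \<bullet> v) / ((y - x) \<bullet> (y - x))) *\<^sub>R (y - x))))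
        (at y within S)" if "y \<in> S" for y
      using has_derivative_inversion[OF Sx[OF that]] by (rule has_derivative_at_withinI)
  qed (use lm in auto)
  then have I: "((\<lambda>y. (r / norm (y - x)) ^ (2 * CARD('n))) has_integral measure lebesgue (inversion x r ` S)) S"
    by (rule has_integral_eq[rotated]) (use Sx in \<open>simp add: abs_det_scaled_reflection power_mult\<close>)
  have "emeasure (distr (density lborel ?J) borel (inversion x r)) A
      = (\<integral>\<^sup>+y. ?J y * indicator (inversion x r -` A) y \<partial>lborel)"
    by (subst emeasure_distr, simp, simp, subst emeasure_density) (use V in auto)
  also have "\<dots> = (\<integral>\<^sup>+y. ennreal ((r / norm (y - x)) ^ (2 * CARD('n))) * indicator S y \<partial>lborel)"
    by (intro nn_integral_cong) (auto simp: S_def indicator_def)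
  also have "\<dots> = ennreal (measure lebesgue (inversion x r ` S))"
    using I by (intro nn_integral_has_integral_lebesgue') (use r in auto)
  also have "\<dots> = emeasure lebesgue (inversion x r ` S)"
    using lm by (intro emeasure_eq_measure2[symmetric])
  also have "\<dots> = emeasure lborel (A \<inter> (ball x r - {x}))"
    unfolding im by simp
  also have "\<dots> = emeasure lborel (A \<inter> ball x r)"
    by (rule emeasure_eq_AE) (use AE_lborel_singleton[of x] in \<open>auto\<close>)
  also have "\<dots> = emeasure (density lborel (indicator (ball x r))) A"
    by (subst emeasure_density)
       (auto simp: Int_commute borel_measurable_indicator simp flip: indicator_inter_arith)
  finally show "emeasure (distr (density lborel ?J) borel (inversion x r)) A
      = emeasure (density lborel (indicator (ball x r))) A" .
qed simp

text \<open>The change of variables theorem of the library needs a well-ordered index type; a copy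
  of the index type carries such an order, and reindexing is a measure-preserving isometry.\<close>

typedef 'a ordered_copy = "UNIV :: 'a set" by simp

instance ordered_copy :: (finite) finite
proof
  have "finite (range (Abs_ordered_copy :: 'a \<Rightarrow> 'a ordered_copy))" by simp
  moreover have "range (Abs_ordered_copy :: 'a \<Rightarrow> 'a ordered_copy) = UNIV"
    by (rule type_definition.Abs_image[OF type_definition_ordered_copy])
  ultimately show "finite (UNIV :: 'a ordered_copy set)" by simp
qed

instantiation ordered_copy :: (finite) wellorder
begin

definition "less_eq_ordered_copy (a :: 'a ordered_copy) (b :: 'a ordered_copy) \<longleftrightarrow> to_nat a \<le> to_nat b"
definition "less_ordered_copy (a :: 'a ordered_copy) (b :: 'a ordered_copy) \<longleftrightarrow> to_nat a < to_nat b"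

instance
proof
  fix P :: "'a ordered_copy \<Rightarrow> bool" and a
  assume step: "\<And>x. (\<And>y. y < x \<Longrightarrow> P y) \<Longrightarrow> P x"
  have "\<forall>a. to_nat a = k \<longrightarrow> P a" for k
    by (induction k rule: less_induct) (metis step less_ordered_copy_def)
  then show "P a" by blast
next
  fix a b :: "'a ordered_copy"
  assume "a \<le> b" "b \<le> a"
  then show "a = b" by (simp add: less_eq_ordered_copy_def)
qed (auto simp only: less_eq_ordered_copy_def less_ordered_copy_def)

end

definition reindex :: "real ^ 'n \<Rightarrow> real ^ 'n ordered_copy" where
  "reindex v = (\<chi> i. v $ Rep_ordered_copy i)"

definition unindex :: "real ^ 'n ordered_copy \<Rightarrow> real ^ 'n" where
  "unindex v = (\<chi> i. v $ Abs_ordered_copy i)"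

lemma unindex_reindex [simp]: "unindex (reindex v) = v"
  by (simp add: unindex_def reindex_def vec_eq_iff Abs_ordered_copy_inverse)

lemma bij_Abs_ordered_copy: "bij (Abs_ordered_copy :: 'a \<Rightarrow> 'a ordered_copy)"
  by (rule bij_betw_byWitness[where f' = Rep_ordered_copy])
     (auto simp: Abs_ordered_copy_inverse Rep_ordered_copy_inverse)

lemma CARD_ordered_copy: "CARD('a::finite ordered_copy) = CARD('a)"
  using bij_betw_same_card[OF bij_Abs_ordered_copy] by metis

lemma linear_unindex: "linear unindex"
  by (rule linearI) (auto simp: unindex_def vec_eq_iff)

lemma norm_unindex: "norm (unindex v) = norm v"
proof -
  have "(\<Sum>i\<in>UNIV. (v $ Abs_ordered_copy i)\<^sup>2) = (\<Sum>i\<in>UNIV. (v $ i)\<^sup>2)"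
    using bij_Abs_ordered_copy by (rule sum.reindex_bij_betw)
  then show ?thesis by (simp add: norm_vec_def L2_set_def unindex_def)
qed

lemma unindex_inversion: "unindex (inversion x r y) = inversion (unindex x) r (unindex y)"
proof -
  have "norm (y - x) = norm (unindex y - unindex x)"
    using norm_unindex[of "y - x"] by (simp add: linear_diff[OF linear_unindex])
  then show ?thesis
    by (simp add: inversion_def linear_add[OF linear_unindex] linear_diff[OF linear_unindex]
        linear_scale[OF linear_unindex])
qed

lemma borel_measurable_unindex [measurable]: "unindex \<in> borel_measurable borel"
  by (intro borel_measurable_continuous_onI linear_continuous_on linear_conv_bounded_linear[THEN iffD1] linear_unindex)

lemma prod_inner_Basis_cart: "(\<Prod>b\<in>Basis. v \<bullet> b) = (\<Prod>i\<in>UNIV. v $ i)" for v :: "real ^ 'n"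
proof -
  have "(Basis :: (real ^ 'n) set) = range (\<lambda>i. axis i 1)"
    by (auto simp: Basis_vec_def)
  moreover have "inj (\<lambda>i. axis i (1::real) :: real ^ 'n)"
    by (auto simp: inj_def axis_eq_axis)
  ultimately show ?thesis
    unfolding \<open>Basis = _\<close> by (subst prod.reindex) (auto simp: inner_axis)
qed

text \<open>Lebesgue measure is determined by boxes, and renaming coordinates preserves the product
  of the side lengths.\<close>

lemma distr_unindex: "distr lborel borel unindex = (lborel :: (real ^ 'n) measure)"
proof (rule lborel_eqI[symmetric])
  fix l u :: "real ^ 'n"
  assume le: "\<And>b. b \<in> Basis \<Longrightarrow> l \<bullet> b \<le> u \<bullet> b"
  then have le': "l $ i \<le> u $ i" for i using le[of "axis i 1" for i] by (simp add: axis_in_Basis_iff inner_axis)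
  have "unindex -` box l u = box (reindex l) (reindex u)"
  proof (intro equalityI subsetI)
    fix v assume "v \<in> unindex -` box l u"
    then have *: "l $ i < v $ Abs_ordered_copy i \<and> v $ Abs_ordered_copy i < u $ i" for i
      by (auto simp: mem_box_cart unindex_def)
    show "v \<in> box (reindex l) (reindex u)"
      using *[of "Rep_ordered_copy _"] by (auto simp: mem_box_cart reindex_def Rep_ordered_copy_inverse)
  next
    fix v assume "v \<in> box (reindex l) (reindex u)"
    then have *: "l $ Rep_ordered_copy i < v $ i \<and> v $ i < u $ Rep_ordered_copy i" for i
      by (auto simp: mem_box_cart reindex_def)
    show "v \<in> unindex -` box l u"
      using *[of "Abs_ordered_copy _"] by (auto simp: mem_box_cart unindex_def Abs_ordered_copy_inverse)
  qed
  then have "emeasure (distr lborel borel unindex) (box l u) = emeasure lborel (box (reindex l) (reindex u))"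
    by (simp add: emeasure_distr)
  also have "\<dots> = ennreal (\<Prod>b\<in>Basis. (reindex u - reindex l) \<bullet> b)"
    using le' by (subst emeasure_lborel_box) (auto simp: Basis_vec_def inner_axis reindex_def)
  also have "(\<Prod>b\<in>Basis. (reindex u - reindex l) \<bullet> b) = (\<Prod>i\<in>UNIV. u $ Rep_ordered_copy i - l $ Rep_ordered_copy i)"
    by (simp add: prod_inner_Basis_cart reindex_def)
  also have "\<dots> = (\<Prod>i\<in>UNIV. u $ i - l $ i)"
    using prod.reindex_bij_betw[OF bij_Abs_ordered_copy, of "\<lambda>i. u $ Rep_ordered_copy i - l $ Rep_ordered_copy i"]
    by (simp add: Abs_ordered_copy_inverse)
  also have "\<dots> = (\<Prod>b\<in>Basis. (u - l) \<bullet> b)"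
    by (simp add: prod_inner_Basis_cart)
  finally show "emeasure (distr lborel borel unindex) (box l u) = ennreal (\<Prod>b\<in>Basis. (u - l) \<bullet> b)" .
qed simp

lemma distr_inversion:
  fixes x :: "real ^ 'n"
  assumes r: "r > 0"
  shows "distr (density lborel (\<lambda>y. indicator {y. r < norm (y - x)} y * ennreal ((r / norm (y - x)) ^ (2 * CARD('n)))))
           borel (inversion x r) = density lborel (indicator (ball x r))"
    (is "distr (density lborel ?J) borel _ = _")
proof -
  define x' where "x' = reindex x"
  let ?J' = "\<lambda>y. indicator {y. r < norm (y - x')} y * ennreal ((r / norm (y - x')) ^ (2 * CARD('n ordered_copy)))"
  have nrm: "norm (unindex y - x) = norm (y - x')" for y
    using norm_unindex[of "y - x'"] by (simp add: linear_diff[OF linear_unindex] x'_def)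
  have J': "?J (unindex y) = ?J' y" for y
    by (simp add: nrm CARD_ordered_copy indicator_def)
  have [measurable]: "ball x r \<in> sets borel" by simp
  have ball': "indicator (ball x r) (unindex y) = (indicator (ball x' r) y :: ennreal)" for y
    using nrm[of y] by (simp add: dist_norm norm_minus_commute indicator_def)
  have "density lborel ?J = density (distr lborel borel unindex) ?J"
    by (simp add: distr_unindex)
  also have "\<dots> = distr (density lborel (\<lambda>y. ?J (unindex y))) borel unindex"
    by (rule density_distr) auto
  finally have "distr (density lborel ?J) borel (inversion x r)
      = distr (density lborel ?J') borel (\<lambda>y. inversion x r (unindex y))"
    by (simp add: J' distr_distr o_def)
  also have "(\<lambda>y. inversion x r (unindex y)) = (\<lambda>y. unindex (inversion x' r y))"
    by (simp add: unindex_inversion x'_def)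
  also have "distr (density lborel ?J') borel (\<lambda>y. unindex (inversion x' r y))
      = distr (distr (density lborel ?J') borel (inversion x' r)) borel unindex"
    by (simp add: distr_distr o_def)
  also have "\<dots> = distr (density lborel (indicator (ball x' r))) borel unindex"
    by (simp add: distr_inversion_wellorder[OF r])
  also have "\<dots> = density (distr lborel borel unindex) (indicator (ball x r))"
    by (subst density_distr) (auto simp: ball')
  also have "\<dots> = density lborel (indicator (ball x r))"
    by (simp add: distr_unindex)
  finally show ?thesis .
qed

lemma inversion_change_of_variables:
  fixes x :: "real ^ 'n" and G :: "real ^ 'n \<Rightarrow> real"
  assumes r: "r > 0" and [measurable]: "G \<in> borel_measurable borel"
    and int: "integrable lborel (\<lambda>y. indicator (ball x r) y * G y)"
  shows "integrable lborel (\<lambda>y. indicator {y. r < norm (y - x)} y *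
             ((r / norm (y - x)) ^ (2 * CARD('n)) * G (inversion x r y)))" (is ?A)
    and "(LINT y|lborel. indicator {y. r < norm (y - x)} y *
             ((r / norm (y - x)) ^ (2 * CARD('n)) * G (inversion x r y)))
         = (LINT y|lborel. indicator (ball x r) y * G y)" (is ?B)
proof -
  have [measurable]: "ball x r \<in> sets borel" by simp
  let ?J = "\<lambda>y. indicator {y. r < norm (y - x)} y * (r / norm (y - x)) ^ (2 * CARD('n)) :: real"
  have J: "(\<lambda>y. indicator {y. r < norm (y - x)} y * ennreal ((r / norm (y - x)) ^ (2 * CARD('n)))) = (\<lambda>y. ennreal (?J y))"
    by (auto simp: indicator_def)
  have B: "indicator (ball x r) = (\<lambda>y. ennreal (indicator (ball x r) y))"
    by (auto simp: indicator_def)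
  have D: "distr (density lborel (\<lambda>y. ennreal (?J y))) borel (inversion x r) = density lborel (\<lambda>y. ennreal (indicator (ball x r) y))"
    using distr_inversion[OF r, of x] unfolding J B .
  have "integrable (density lborel (\<lambda>y. ennreal (indicator (ball x r) y))) G"
    using int by (subst integrable_density) auto
  then have "integrable (density lborel (\<lambda>y. ennreal (?J y))) (\<lambda>y. G (inversion x r y))"
    unfolding D[symmetric] by (subst (asm) integrable_distr_eq) auto
  then show ?A
    by (subst (asm) integrable_density) (use r in \<open>auto simp: mult.assoc\<close>)
  have "(LINT y|lborel. indicator (ball x r) y * G y) = (LINT y|density lborel (\<lambda>y. ennreal (indicator (ball x r) y)). G y)"
    by (subst integral_density) auto
  also have "\<dots> = (LINT y|density lborel (\<lambda>y. ennreal (?J y)). G (inversion x r y))"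
    unfolding D[symmetric] by (subst integral_distr) auto
  also have "\<dots> = (LINT y|lborel. ?J y * G (inversion x r y))"
    by (subst integral_density) (use r in auto)
  finally show ?B by (simp add: mult.assoc)
qed

section \<open>The reflected kernel\<close>

text \<open>Divide \<open>norm_inversion_diff_sq\<close> by l^2: the squared weighted distance
  becomes |z - y|^2 + \<tau> (|y - x|^2 - l^2). The closeness of z to the sphere enters through
  \<tau>. The exponent is written as 2 q because the identity is one between squares.\<close>

lemma reflected_kernel:
  fixes x y z :: "'a::real_inner"
  assumes "0 < l" "z \<noteq> x" "y \<noteq> z"
    and tau: "\<tau> = ((norm (z - x))\<^sup>2 - l\<^sup>2) / l\<^sup>2"
    and pos: "0 \<le> \<tau> * ((norm (y - x))\<^sup>2 - l\<^sup>2)"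
  shows "(l / norm (z - x)) powr (2 * q) * norm (inversion x l z - y) powr (- (2 * q)) =
    norm (z - y) powr (- (2 * q)) *
      (1 + \<tau> * ((norm (y - x))\<^sup>2 - l\<^sup>2) / (norm (z - y))\<^sup>2) powr (- q)"
proof -
  define A where "A = (norm (z - y))\<^sup>2"
  define D where "D = \<tau> * ((norm (y - x))\<^sup>2 - l\<^sup>2)"
  have "A > 0" using assms by (simp add: A_def)
  have s: "norm (z - x) > 0" using assms by simp
  have "(norm (z - x) * norm (inversion x l z - y) / l)\<^sup>2 = A + D"
    unfolding power_divide power_mult_distrib norm_inversion_diff_sq[OF \<open>z \<noteq> x\<close>] A_def D_def tau
    using \<open>0 < l\<close> by (simp add: field_simps)
  then have "sqrt (A + D) = norm (z - x) * norm (inversion x l z - y) / l"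
    using \<open>0 < l\<close> by (intro real_sqrt_unique) auto
  then have N: "norm (inversion x l z - y) = l / norm (z - x) * sqrt (A + D)"
    using s \<open>0 < l\<close> by (simp add: field_simps)
  have AD: "A + D = A * (1 + D / A)" using \<open>A > 0\<close> by (simp add: field_simps)
  have "D / A \<ge> 0" using pos \<open>A > 0\<close> by (simp add: D_def)
  have sq: "sqrt B powr (- (2 * q)) = B powr (- q)" if "B > 0" for B
    using that by (simp add: powr_half_sqrt[symmetric] powr_powr)
  have "A + D > 0" using AD \<open>A > 0\<close> \<open>D / A \<ge> 0\<close> by (simp add: add_pos_nonneg)
  have "(l / norm (z - x)) powr (2 * q) * norm (inversion x l z - y) powr (- (2 * q)) = sqrt (A + D) powr (- (2 * q))"
    unfolding N using s \<open>0 < l\<close> \<open>A + D > 0\<close>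
    by (subst powr_mult) (auto simp: powr_minus field_simps)
  also have "\<dots> = A powr (- q) * (1 + D / A) powr (- q)"
    using \<open>A > 0\<close> \<open>A + D > 0\<close> \<open>D / A \<ge> 0\<close> by (subst sq, simp, subst AD, subst powr_mult) auto
  also have "A powr (- q) = norm (z - y) powr (- (2 * q))"
    using \<open>A > 0\<close> sq[of A] by (simp add: A_def)
  finally show ?thesis by (simp add: A_def D_def)
qed

text \<open>The factor 12 is the ratio of \<open>4 * \<tau>\<close> in
  \<open>kernel_difference_far\<close> to \<open>\<tau> / 3\<close> in
  \<open>kernel_difference_annulus\<close>. Bernoulli's inequality is used twice, for
  \<open>1 + t\<close> and for its power \<open>?v\<close>.\<close>

lemma one_minus_powr_scale:
  fixes t q :: real
  assumes "t \<ge> 0" "q > 0"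
  shows "1 - (1 + 12 * t) powr (- q) \<le> 12 * (1 - (1 + t) powr (- q))"
proof -
  let ?v = "(1 + t) powr (- q)"
  have "1 + 12 * t \<le> (1 + t) ^ 12"
    using Bernoulli_inequality[of t 12] assms by simp
  then have "((1 + t) ^ 12) powr (- q) \<le> (1 + 12 * t) powr (- q)"
    using assms by (intro powr_mono2') auto
  moreover have "((1 + t) ^ 12) powr (- q) = ?v ^ 12"
  proof -
    have "(1 + t) ^ 12 = (1 + t) powr 12" using assms by simp
    moreover have "?v ^ 12 = ?v powr 12" using assms by simp
    ultimately show ?thesis by (simp only: powr_powr) (simp add: mult.commute)
  qed
  moreover have "1 - 12 * (1 - ?v) \<le> ?v ^ 12"
    using Bernoulli_inequality[of "?v - 1" 12] by (simp add: algebra_simps)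
  ultimately show ?thesis by linarith
qed

lemma one_plus_powr_neg_le_one:
  fixes a q :: real
  assumes "a \<ge> 0" "q > 0"
  shows "(1 + a) powr (- q) \<le> 1"
  using powr_mono2'[of "- q" 1 "1 + a"] assms by simp

lemma reflected_kernel_le:
  fixes x y z :: "'a::real_inner"
  assumes "0 < l" "l < norm (z - x)" "l < norm (y - x)" "y \<noteq> z" "q > 0"
  shows "(l / norm (z - x)) powr (2 * q) * norm (inversion x l z - y) powr (- (2 * q))
    \<le> norm (z - y) powr (- (2 * q))"
proof -
  define \<tau> where "\<tau> = ((norm (z - x))\<^sup>2 - l\<^sup>2) / l\<^sup>2"
  have "l\<^sup>2 < (norm (z - x))\<^sup>2" "l\<^sup>2 < (norm (y - x))\<^sup>2"
    using assms by (simp_all add: power_strict_mono)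
  then have *: "0 \<le> \<tau> * ((norm (y - x))\<^sup>2 - l\<^sup>2)" by (simp add: \<tau>_def)
  have "z \<noteq> x" using assms by auto
  have "(1 + \<tau> * ((norm (y - x))\<^sup>2 - l\<^sup>2) / (norm (z - y))\<^sup>2) powr (- q) \<le> 1"
    using * assms by (intro one_plus_powr_neg_le_one) auto
  then show ?thesis
    unfolding reflected_kernel[OF \<open>0 < l\<close> \<open>z \<noteq> x\<close> \<open>y \<noteq> z\<close> \<tau>_def *]
    by (intro mult_left_le) auto
qed

text \<open>Here |y - x| > 2 l and |z - y| <= 3/2 |y - x|, so (|y - x|^2 - l^2) / |z - y|^2 is at
  least (3/4) / (9/4) = 1/3. The prefactor is at least 1 because |z - y| <= 1.\<close>

lemma kernel_difference_annulus:
  fixes x y z :: "'a::real_inner"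
  assumes "0 < l" "l < norm (z - x)" "norm (z - x) < 1 / 8" "1 / 4 < norm (y - x)" "norm (y - x) < 1 / 2" "q > 0"
    and tau: "\<tau> = ((norm (z - x))\<^sup>2 - l\<^sup>2) / l\<^sup>2"
  shows "1 - (1 + \<tau> / 3) powr (- q) \<le> norm (z - y) powr (- (2 * q)) -
    (l / norm (z - x)) powr (2 * q) * norm (inversion x l z - y) powr (- (2 * q))"
proof -
  define r where "r = norm (y - x)"
  define A where "A = (norm (z - y))\<^sup>2"
  have ls: "l\<^sup>2 < (norm (z - x))\<^sup>2" using assms by (simp add: power_strict_mono)
  then have \<tau>0: "\<tau> > 0" using \<open>0 < l\<close> by (simp add: tau)
  have lr: "4 * l\<^sup>2 < r\<^sup>2"
    using power_strict_mono[of "2 * l" r 2] assms by (simp add: r_def power_mult_distrib)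
  then have *: "0 \<le> \<tau> * (r\<^sup>2 - l\<^sup>2)"
    using \<tau>0 zero_le_power2[of l] by (intro mult_nonneg_nonneg) linarith+
  have ne: "y \<noteq> z" "z \<noteq> x" using assms by auto
  have "norm (z - y) \<le> norm (z - x) + r"
    using norm_triangle_ineq4[of "z - x" "y - x"] by (simp add: r_def)
  then have zy: "norm (z - y) \<le> 3 / 2 * r" using assms by (simp add: r_def)
  have A: "A \<le> 9 / 4 * r\<^sup>2"
    unfolding A_def using power_mono[OF zy, of 2] by (simp add: power_mult_distrib power2_eq_square)
  have A0: "A > 0" using ne by (simp add: A_def)
  have "1 / 3 \<le> (r\<^sup>2 - l\<^sup>2) / A"
    using A A0 lr by (simp add: field_simps)
  then have "\<tau> / 3 \<le> \<tau> * (r\<^sup>2 - l\<^sup>2) / A"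
    using mult_left_mono[of "1/3" "(r\<^sup>2 - l\<^sup>2) / A" \<tau>] \<tau>0 by simp
  then have B: "(1 + \<tau> * (r\<^sup>2 - l\<^sup>2) / A) powr (- q) \<le> (1 + \<tau> / 3) powr (- q)"
    using \<tau>0 assms by (intro powr_mono2') auto
  have "norm (z - y) \<le> 1" using zy assms by (simp add: r_def)
  then have C: "1 \<le> norm (z - y) powr (- (2 * q))"
    using ne assms powr_mono2'[of "- (2 * q)" "norm (z - y)" 1] by simp
  have D: "(1 + \<tau> / 3) powr (- q) \<le> 1"
    using \<tau>0 assms by (intro one_plus_powr_neg_le_one) auto
  have "1 - (1 + \<tau> / 3) powr (- q) \<le> 1 - (1 + \<tau> * (r\<^sup>2 - l\<^sup>2) / A) powr (- q)"
    using B by simp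
  also have "\<dots> \<le> norm (z - y) powr (- (2 * q)) * (1 - (1 + \<tau> * (r\<^sup>2 - l\<^sup>2) / A) powr (- q))"
    using mult_right_mono[OF C, of "1 - (1 + \<tau> * (r\<^sup>2 - l\<^sup>2) / A) powr (- q)"] B D by simp
  also have "\<dots> = norm (z - y) powr (- (2 * q)) -
    (l / norm (z - x)) powr (2 * q) * norm (inversion x l z - y) powr (- (2 * q))"
    unfolding reflected_kernel[OF \<open>0 < l\<close> \<open>z \<noteq> x\<close> \<open>y \<noteq> z\<close> tau *[unfolded r_def]] A_def r_def
    by (simp add: algebra_simps)
  finally show ?thesis .
qed

text \<open>Here |z - y| >= |y - x| / 2 bounds the same quotient by 4, and |z - y| >= 1/4 bounds the
  prefactor by 16^q. Expressing the bound through the quantity used in the annulus makes the ratio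
  of loss to gain independent of z and l.\<close>

lemma kernel_difference_far:
  fixes x y z :: "'a::real_inner"
  assumes "0 < l" "l < norm (z - x)" "norm (z - x) < 1 / 8" "1 / 2 \<le> norm (y - x)" "q > 0"
    and tau: "\<tau> = ((norm (z - x))\<^sup>2 - l\<^sup>2) / l\<^sup>2"
  shows "norm (z - y) powr (- (2 * q)) -
    (l / norm (z - x)) powr (2 * q) * norm (inversion x l z - y) powr (- (2 * q))
    \<le> 12 * 16 powr q * (1 - (1 + \<tau> / 3) powr (- q))"
proof -
  define r where "r = norm (y - x)"
  define A where "A = (norm (z - y))\<^sup>2"
  have ls: "l\<^sup>2 < (norm (z - x))\<^sup>2" using assms by (simp add: power_strict_mono)
  then have \<tau>0: "\<tau> > 0" using \<open>0 < l\<close> by (simp add: tau)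
  have lr: "l\<^sup>2 < r\<^sup>2" using assms by (simp add: r_def power_strict_mono)
  then have *: "0 \<le> \<tau> * (r\<^sup>2 - l\<^sup>2)"
    using \<tau>0 zero_le_power2[of l] by (intro mult_nonneg_nonneg) linarith+
  have ne: "y \<noteq> z" "z \<noteq> x" using assms by auto
  have "r - norm (z - x) \<le> norm (z - y)"
    using norm_triangle_ineq2[of "y - x" "z - x"] by (simp add: r_def norm_minus_commute)
  then have zy: "r / 2 \<le> norm (z - y)" using assms by (simp add: r_def)
  have A: "r\<^sup>2 / 4 \<le> A"
    unfolding A_def using power_mono[OF zy, of 2] assms by (simp add: power_divide r_def)
  have A0: "A > 0" using ne by (simp add: A_def)
  have "(r\<^sup>2 - l\<^sup>2) / A \<le> 4"
  proof -
    have "r\<^sup>2 - l\<^sup>2 \<le> 4 * A" using A zero_le_power2[of l] by linarith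
    then show ?thesis using A0 by (simp add: divide_le_eq)
  qed
  then have "\<tau> * (r\<^sup>2 - l\<^sup>2) / A \<le> 4 * \<tau>"
    using mult_left_mono[of "(r\<^sup>2 - l\<^sup>2) / A" 4 \<tau>] \<tau>0 by simp
  moreover have "0 \<le> \<tau> * (r\<^sup>2 - l\<^sup>2) / A" using * A0 by simp
  ultimately have B: "(1 + 4 * \<tau>) powr (- q) \<le> (1 + \<tau> * (r\<^sup>2 - l\<^sup>2) / A) powr (- q)"
    using assms by (intro powr_mono2') auto
  have "1 / 4 \<le> norm (z - y)" using zy assms by (simp add: r_def)
  then have "norm (z - y) powr (- (2 * q)) \<le> (1 / 4) powr (- (2 * q))"
    using assms by (intro powr_mono2') auto
  also have "\<dots> = 16 powr q"
  proof -
    have "(1 / 4) powr (- (2 * q)) = (4::real) powr (2 * q)"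
      by (simp add: powr_minus powr_divide)
    also have "\<dots> = (4 powr 2) powr q" by (simp only: powr_powr)
    finally show ?thesis by simp
  qed
  finally have C: "norm (z - y) powr (- (2 * q)) \<le> 16 powr q" .
  have D: "(1 + 4 * \<tau>) powr (- q) \<le> 1"
    using \<tau>0 assms by (intro one_plus_powr_neg_le_one) auto
  have "norm (z - y) powr (- (2 * q)) -
    (l / norm (z - x)) powr (2 * q) * norm (inversion x l z - y) powr (- (2 * q))
     = norm (z - y) powr (- (2 * q)) * (1 - (1 + \<tau> * (r\<^sup>2 - l\<^sup>2) / A) powr (- q))"
    unfolding reflected_kernel[OF \<open>0 < l\<close> \<open>z \<noteq> x\<close> \<open>y \<noteq> z\<close> tau *[unfolded r_def]] A_def r_def
    by (simp add: algebra_simps)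
  also have "\<dots> \<le> norm (z - y) powr (- (2 * q)) * (1 - (1 + 4 * \<tau>) powr (- q))"
    using B by (intro mult_left_mono) auto
  also have "\<dots> \<le> 16 powr q * (1 - (1 + 4 * \<tau>) powr (- q))"
    using C D by (intro mult_right_mono) auto
  also have "\<dots> \<le> 16 powr q * (12 * (1 - (1 + \<tau> / 3) powr (- q)))"
    using one_minus_powr_scale[of "\<tau> / 3" q] \<tau>0 \<open>q > 0\<close> by (intro mult_left_mono) auto
  finally show ?thesis by (simp only: ac_simps)
qed

text \<open>Along a ray from x the function t^q h(x + t \<theta>) is nondecreasing for small t,
  since its derivative has the sign of q h + t h'(\<theta>). The claim compares its values at l^2/s
  and s, where s = |z - x|, because (l/s)^(2q) = (l^2/s)^q / s^q.\<close>

lemma C1_kelvin_le: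
  fixes h :: "'a::euclidean_space \<Rightarrow> real"
  assumes h: "C1_on (ball 0 2) h" and pos: "\<And>x. x \<in> ball 0 2 \<Longrightarrow> h x > 0" and q: "q > 0"
  obtains r where "0 < r" "r < 1 / 8"
    "\<And>x l z. norm x \<le> 3 / 2 \<Longrightarrow> 0 < l \<Longrightarrow> l < norm (z - x) \<Longrightarrow> norm (z - x) < r \<Longrightarrow>
       (l / norm (z - x)) powr (2 * q) * h (inversion x l z) \<le> h z"
proof -
  from h obtain h' :: "'a \<Rightarrow> 'a \<Rightarrow>\<^sub>L real"
    where h': "\<And>x. x \<in> ball 0 2 \<Longrightarrow> (h has_derivative blinfun_apply (h' x)) (at x)"
      and h'c: "continuous_on (ball 0 2) h'"
    unfolding C1_on_def by blast
  let ?K = "cball (0::'a) (7 / 4)"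
  have K: "?K \<subseteq> ball 0 2" by auto
  have "continuous_on ?K h"
    using h' K by (meson continuous_at_imp_continuous_on has_derivative_continuous subset_iff)
  then obtain x0 where x0: "x0 \<in> ?K" "\<And>x. x \<in> ?K \<Longrightarrow> h x0 \<le> h x"
    using continuous_attains_inf[of ?K h] by fastforce
  define m where "m = h x0"
  have m: "m > 0" using pos x0 K by (auto simp: m_def)
  have "compact (h' ` ?K)"
    using h'c K by (intro compact_continuous_image) (auto intro: continuous_on_subset)
  then obtain H where H: "H > 0" "\<And>x. x \<in> ?K \<Longrightarrow> norm (h' x) \<le> H"
    using compact_imp_bounded bounded_pos by (metis imageI)
  \<comment> \<open>The first bound keeps the segment from x inside \<open>?K\<close>; the second
    gives t |h'| <= q m <= q h on it.\<close>
  define r where "r = min (1 / 16) (q * m / H)"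
  show ?thesis
  proof (rule that[of r])
    show "0 < r" "r < 1 / 8" using q m H by (auto simp: r_def)
    fix x z :: 'a and l assume x: "norm x \<le> 3 / 2" and l: "0 < l" "l < norm (z - x)" "norm (z - x) < r"
    define s where "s = norm (z - x)"
    define \<theta> where "\<theta> = (1 / s) *\<^sub>R (z - x)"
    have s: "0 < s" using less_trans[OF l(1,2)] unfolding s_def .
    have \<theta>: "norm \<theta> = 1" using s by (simp add: \<theta>_def s_def)
    have z: "z = x + s *\<^sub>R \<theta>" using s by (simp add: \<theta>_def)
    have zx: "z \<noteq> x" using s by (auto simp: s_def)
    have iz: "inversion x l z = x + (l\<^sup>2 / s) *\<^sub>R \<theta>"
      using s zx by (simp add: inversion_def \<theta>_def s_def[symmetric] power_divide power2_eq_square)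
    have ls: "l\<^sup>2 / s \<le> s"
      using l s by (simp add: s_def[symmetric] divide_le_eq power2_eq_square mult_mono)
    have "(l\<^sup>2 / s) powr q * h (x + (l\<^sup>2 / s) *\<^sub>R \<theta>) \<le> s powr q * h (x + s *\<^sub>R \<theta>)"
    proof (rule DERIV_nonneg_imp_nondecreasing[OF ls])
      fix t assume t: "l\<^sup>2 / s \<le> t" "t \<le> s"
      have t0: "t > 0" using t l s by (meson divide_pos_pos less_le_trans zero_less_power)
      have tr: "t < r" using t l s_def by simp
      have "norm (x + t *\<^sub>R \<theta>) \<le> 7 / 4"
        using norm_triangle_ineq[of x "t *\<^sub>R \<theta>"] \<theta> t0 tr x by (simp add: r_def)
      then have tK: "x + t *\<^sub>R \<theta> \<in> ?K" by simp
      then have tB: "x + t *\<^sub>R \<theta> \<in> ball 0 2" using K by blast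
      have "((\<lambda>t. h (x + t *\<^sub>R \<theta>)) has_derivative (\<lambda>s. h' (x + t *\<^sub>R \<theta>) (s *\<^sub>R \<theta>))) (at t)"
        by (rule has_derivative_compose[of "\<lambda>t. x + t *\<^sub>R \<theta>" _ _ _ h, OF _ h'[OF tB]])
           (auto intro!: derivative_eq_intros)
      then have 1: "((\<lambda>t. h (x + t *\<^sub>R \<theta>)) has_real_derivative h' (x + t *\<^sub>R \<theta>) \<theta>) (at t)"
        unfolding has_field_derivative_def
        by (rule has_derivative_eq_rhs) (simp add: fun_eq_iff blinfun.scaleR_right)
      have 2: "((\<lambda>t. t powr q) has_real_derivative q * t powr (q - 1)) (at t)"
        using t0 by (rule has_real_derivative_powr)
      have "\<bar>h' (x + t *\<^sub>R \<theta>) \<theta>\<bar> \<le> H"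
        using norm_blinfun[of "h' (x + t *\<^sub>R \<theta>)" \<theta>] H(2)[OF tK] \<theta> by simp
      then have "t * (- h' (x + t *\<^sub>R \<theta>) \<theta>) \<le> t * H"
        using t0 by (intro mult_left_mono) auto
      then have "- (t * h' (x + t *\<^sub>R \<theta>) \<theta>) \<le> r * H"
        using mult_strict_right_mono[OF tr H(1)] by linarith
      also have "r * H \<le> q * m"
        using H(1) min.cobounded2[of "1 / 16" "q * m / H"] unfolding r_def[symmetric]
        by (simp add: pos_le_divide_eq)
      also have "\<dots> \<le> q * h (x + t *\<^sub>R \<theta>)"
        using x0(2)[OF tK] q by (simp add: m_def)
      finally have nn: "0 \<le> t powr (q - 1) * (q * h (x + t *\<^sub>R \<theta>) + t * h' (x + t *\<^sub>R \<theta>) \<theta>)"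
        by simp
      have tq: "t powr q = t * t powr (q - 1)" using t0 by (simp add: powr_diff)
      have "((\<lambda>t. t powr q * h (x + t *\<^sub>R \<theta>)) has_real_derivative
          t powr (q - 1) * (q * h (x + t *\<^sub>R \<theta>) + t * h' (x + t *\<^sub>R \<theta>) \<theta>)) (at t)"
        by (rule DERIV_cong[OF DERIV_mult[OF 2 1]]) (simp add: tq algebra_simps)
      then show "\<exists>y. ((\<lambda>t. t powr q * h (x + t *\<^sub>R \<theta>)) has_real_derivative y) (at t) \<and> 0 \<le> y"
        using nn by blast
    qed
    then have *: "(l\<^sup>2 / s) powr q * h (inversion x l z) \<le> s powr q * h z"
      unfolding iz z[symmetric] by simp
    have "(l / s) powr (2 * q) = ((l / s)\<^sup>2) powr q"
    proof -
      have "0 < l / s" using l s by simp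
      then have "(l / s)\<^sup>2 = (l / s) powr 2" by (simp only: powr_numeral)
      then show ?thesis by (simp only: powr_powr)
    qed
    also have "(l / s)\<^sup>2 = l\<^sup>2 / s * (1 / s)" by (simp add: power2_eq_square)
    also have "\<dots> powr q = (l\<^sup>2 / s) powr q / s powr q"
      using l s by (subst powr_mult) (auto simp: powr_divide)
    finally have e: "(l / s) powr (2 * q) = (l\<^sup>2 / s) powr q / s powr q" .
    have "(l / s) powr (2 * q) * h (inversion x l z) \<le> h z"
      unfolding e using * s by (simp add: pos_divide_le_eq mult.commute)
    then show "(l / norm (z - x)) powr (2 * q) * h (inversion x l z) \<le> h z"
      by (simp add: s_def)
  qed
qed

section \<open>Solutions of the integral equation\<close>

locale integral_solution =
  fixes \<sigma> :: real and \<Sigma> :: "(real ^ 'n) set" and h u :: "real ^ 'n \<Rightarrow> real"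
  assumes sigma_pos: "0 < \<sigma>" and sigma_less: "\<sigma> < real CARD('n) / 2"
    and closed_sing: "closed \<Sigma>" and null_sing: "\<Sigma> \<in> null_sets lebesgue"
    and h_C1: "C1_on (ball 0 2) h" and h_pos: "\<And>x. x \<in> ball 0 2 \<Longrightarrow> h x > 0"
    and u_cont: "continuous_on (ball 0 2 - \<Sigma>) u" and u_pos: "\<And>x. x \<in> ball 0 2 - \<Sigma> \<Longrightarrow> u x > 0"
    and u_eq: "solves_integral_eq \<sigma> h \<Sigma> u"
begin

definition "\<gamma> = real CARD('n) - 2 * \<sigma>"
definition "p = (real CARD('n) + 2 * \<sigma>) / \<gamma>"
definition "\<Omega> = ball 0 2 - \<Sigma>"
text \<open>Cutting off at \<Omega> instead of the ball changes integrals by the null set \<Sigma>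
  only. Continuity of u on the open set \<Omega> then makes the density Borel measurable, so that
  later integrals can be taken over \<open>lborel\<close>.\<close>

definition "f y = indicator \<Omega> y * u y powr p"

lemma gamma_pos: "\<gamma> > 0"
  using sigma_less by (simp add: \<gamma>_def)

lemma gamma_p: "\<gamma> * p = real CARD('n) + 2 * \<sigma>"
  using gamma_pos by (simp add: p_def)

lemma p_gt_1: "p > 1"
  using gamma_pos sigma_pos by (simp add: p_def \<gamma>_def)

lemma open_\<Omega>: "open \<Omega>"
  unfolding \<Omega>_def using closed_sing by (intro open_Diff) auto

lemma \<Omega>_measurable [measurable]: "\<Omega> \<in> sets borel"
  using open_\<Omega> by simp

lemma \<Omega>_subset: "\<Omega> \<subseteq> ball 0 2"
  by (auto simp: \<Omega>_def)

lemma continuous_on_u: "continuous_on \<Omega> u"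
  using u_cont by (simp add: \<Omega>_def)

lemma u_pos': "x \<in> \<Omega> \<Longrightarrow> u x > 0"
  using u_pos by (simp add: \<Omega>_def)

lemma AE_\<Omega>: "AE y in lborel. y \<in> ball 0 2 \<longrightarrow> y \<in> \<Omega>"
proof -
  have "\<Sigma> \<in> sets lborel" using closed_sing by simp
  then have "\<Sigma> \<in> null_sets lborel"
    using null_sing by (auto simp: null_sets_def)
  then have "AE y in lborel. y \<notin> \<Sigma>" by (rule AE_not_in)
  then show ?thesis by eventually_elim (auto simp: \<Omega>_def)
qed

lemma f_\<Omega>: "y \<in> \<Omega> \<Longrightarrow> f y = u y powr p"
  by (simp add: f_def)

lemma f_nonneg: "f y \<ge> 0"
  by (simp add: f_def)

lemma f_measurable [measurable]: "f \<in> borel_measurable borel"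
proof -
  have "(\<lambda>y. indicator \<Omega> y *\<^sub>R (u y powr p)) \<in> borel_measurable borel"
    using continuous_on_u u_pos'
    by (intro borel_measurable_continuous_on_indicator \<Omega>_measurable continuous_on_powr continuous_on_const) force+
  then show ?thesis by (simp add: f_def[abs_def])
qed

lemma
  assumes "z \<in> \<Omega>"
  shows integrable_f_kernel: "integrable lborel (\<lambda>y. f y * norm (z - y) powr (- \<gamma>))" (is ?A)
    and integral_equation: "u z = (LINT y|lborel. f y * norm (z - y) powr (- \<gamma>)) + h z" (is ?B)
proof -
  let ?F = "\<lambda>y. indicator (ball 0 2) y *\<^sub>R (u y powr p / norm (z - y) powr \<gamma>)"
  let ?G = "\<lambda>y. f y * norm (z - y) powr (- \<gamma>)"
  have F: "integrable lebesgue ?F" and E: "u z = (LINT y|lebesgue. ?F y) + h z"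
    using u_eq assms
    unfolding solves_integral_eq_def set_integrable_def set_lebesgue_integral_def Let_def
      \<gamma>_def[symmetric] p_def[symmetric] \<Omega>_def by auto
  have "AE y in lebesgue. y \<in> ball 0 2 \<longrightarrow> y \<in> \<Omega>"
    using AE_\<Omega> by (rule AE_completion)
  then have AE: "AE y in lebesgue. ?F y = ?G y"
    by eventually_elim
       (use \<Omega>_subset in \<open>auto simp: f_def powr_minus divide_inverse indicator_def\<close>)
  have G: "?G \<in> borel_measurable lborel" by measurable
  then have G': "?G \<in> borel_measurable lebesgue" by (rule measurable_completion)
  have "integrable lebesgue ?G"
    using F AE by (rule integrable_cong_AE_imp[OF _ G']) 
  then show ?A using integrable_completion[OF G] by simp
  have "(LINT y|lebesgue. ?F y) = (LINT y|lebesgue. ?G y)"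
    using F G' AE by (intro integral_cong_AE) auto
  then show ?B using E integral_completion[OF G] by simp
qed

section \<open>A positive lower bound for the solution and uniform smallness of kernel
  integrals\<close>

lemma not_AE_outside_ball: "\<not> (AE y in lborel. y \<notin> ball (0 :: real ^ 'n) 2)"
proof
  assume "AE y in lborel. y \<notin> ball (0 :: real ^ 'n) 2"
  then have "ball (0 :: real ^ 'n) 2 \<in> null_sets lborel"
    by (subst AE_iff_null_sets) auto
  then have "measure lborel (ball (0 :: real ^ 'n) 2) = 0"
    by (simp add: null_sets_def measure_def)
  then show False using content_ball_pos[of 2 "0 :: real ^ 'n"] by simp
qed

lemma \<Omega>_nonempty: "\<Omega> \<noteq> {}"
  using AE_\<Omega> not_AE_outside_ball by auto

text \<open>Points of B_2 are less than 4 apart, so the kernel is at least 4^(-\<gamma>) and u is at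
  least 4^(-\<gamma>) times the total mass of \<open>f\<close>.\<close>

lemma u_lower_bound: obtains c where "c > 0" "\<And>z. z \<in> \<Omega> \<Longrightarrow> c \<le> u z"
proof -
  let ?c = "4 powr (- \<gamma>) :: real"
  \<comment> \<open>At \<open>y = z\<close> the kernel takes the value 0 and the bound fails, so it
    is used almost everywhere.\<close>
  have kernel: "?c * f y \<le> f y * norm (z - y) powr (- \<gamma>)" if "z \<in> \<Omega>" "y \<noteq> z" for y z
  proof (cases "y \<in> \<Omega>")
    case True
    then have "norm z < 2" "norm y < 2" using that \<Omega>_subset by auto
    then have "norm (z - y) \<le> 4" using norm_triangle_ineq4[of z y] by linarith
    then have "?c \<le> norm (z - y) powr (- \<gamma>)"
      using that gamma_pos by (intro powr_mono2') auto
    then show ?thesis using f_nonneg[of y] mult_left_mono by (fastforce simp: mult.commute)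
  qed (simp add: f_def)
  have AE: "AE y in lborel. ?c * f y \<le> f y * norm (z - y) powr (- \<gamma>)" if "z \<in> \<Omega>" for z
    using AE_lborel_singleton[of z] by eventually_elim (use kernel that in auto)
  obtain z0 where z0: "z0 \<in> \<Omega>" using \<Omega>_nonempty by auto
  have int: "integrable lborel (\<lambda>y. ?c * f y)"
    by (rule Bochner_Integration.integrable_bound[OF integrable_f_kernel[OF z0]], simp)
       (use AE[OF z0] f_nonneg in \<open>auto simp: abs_mult\<close>)
  define c where "c = (LINT y|lborel. ?c * f y)"
  have "c \<noteq> 0"
  proof
    assume "c = 0"
    then have "AE y in lborel. ?c * f y = 0"
      using integral_nonneg_eq_0_iff_AE[OF int] f_nonneg by (simp add: c_def)
    then have "AE y in lborel. y \<notin> ball (0 :: real ^ 'n) 2"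
      using AE_\<Omega> by eventually_elim (use u_pos' in \<open>force simp: f_def\<close>)
    then show False using not_AE_outside_ball by blast
  qed
  moreover have "c \<ge> 0" unfolding c_def using f_nonneg by (intro integral_nonneg_AE) auto
  moreover have "c \<le> u z" if "z \<in> \<Omega>" for z
  proof -
    have "c \<le> (LINT y|lborel. f y * norm (z - y) powr (- \<gamma>))"
      unfolding c_def using int integrable_f_kernel[OF that] AE[OF that] by (rule integral_mono_AE)
    then show ?thesis using integral_equation[OF that] h_pos[of z] that \<Omega>_subset by force
  qed
  ultimately show ?thesis using that[of c] by force
qed

text \<open>Local integrability of the kernel is read off from the equation, because \<open>u\<close> is bounded below.\<close>

lemma kernel_locally_integrable:
  obtains d where "d > 0" "integrable lborel (\<lambda>y :: real ^ 'n. indicator (ball 0 d) y * norm y powr (- \<gamma>))"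
proof -
  obtain c where c: "c > 0" "\<And>z. z \<in> \<Omega> \<Longrightarrow> c \<le> u z" using u_lower_bound by blast
  obtain z where z: "z \<in> \<Omega>" using \<Omega>_nonempty by auto
  then obtain d where d: "d > 0" "ball z d \<subseteq> \<Omega>" using open_\<Omega> openE by blast
  let ?G = "\<lambda>y. c powr p * (indicator (ball z d) y * norm (z - y) powr (- \<gamma>))"
  have meas [measurable]: "ball z d \<in> sets borel" "ball (0 :: real ^ 'n) d \<in> sets borel" by simp_all
  have "\<bar>?G y\<bar> \<le> \<bar>f y * norm (z - y) powr (- \<gamma>)\<bar>" for y
  proof (cases "y \<in> ball z d")
    case True
    then have "y \<in> \<Omega>" using d by blast
    then have "c powr p \<le> f y"
      using c p_gt_1 by (auto simp: f_\<Omega> intro!: powr_mono2)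
    then show ?thesis using True f_nonneg[of y] by (simp add: abs_mult mult_right_mono)
  qed simp
  then have "integrable lborel ?G"
    by (intro Bochner_Integration.integrable_bound[OF integrable_f_kernel[OF z]]) auto
  then have "integrable lborel (\<lambda>y. indicator (ball z d) y * norm (z - y) powr (- \<gamma>))"
    using c by simp
  then have "integrable (distr lborel borel ((+) z)) (\<lambda>y. indicator (ball z d) y * norm (z - y) powr (- \<gamma>))"
    by (simp add: lborel_distr_plus)
  then have "integrable lborel (\<lambda>y. indicator (ball z d) (z + y) * norm (z - (z + y)) powr (- \<gamma>))"
    by (subst (asm) integrable_distr_eq) auto
  moreover have "indicator (ball z d) (z + y) = (indicator (ball 0 d) y :: real)" for y
    by (simp add: indicator_def dist_norm)
  ultimately show ?thesis using d that by simp
qed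

text \<open>Split at distance s from z: beyond it the kernel is at most s^(-\<gamma>), which the
  choice of \<delta> compensates, and the part within s has an integral that does not depend on z.
  Uniformity in z and in the shape of E is what the argument for small bad sets requires.\<close>

lemma kernel_small:
  assumes "\<epsilon> > 0"
  obtains \<delta> where "\<delta> > 0"
    "\<And>(z :: real ^ 'n) E. E \<in> fmeasurable lborel \<Longrightarrow> measure lborel E < \<delta> \<Longrightarrow>
       integrable lborel (\<lambda>y. indicator E y * norm (z - y) powr (- \<gamma>)) \<and>
       (LINT y|lborel. indicator E y * norm (z - y) powr (- \<gamma>)) < \<epsilon>"
proof -
  obtain d where d: "d > 0" and
    int: "integrable lborel (\<lambda>y :: real ^ 'n. indicator (ball 0 d) y * norm y powr (- \<gamma>))"
    by (rule kernel_locally_integrable)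
  let ?k = "\<lambda>t (y :: real ^ 'n). indicator (ball 0 t) y * norm y powr (- \<gamma>) :: real"
  have meas [measurable]: "ball z t \<in> sets borel" for z :: "real ^ 'n" and t by simp
  define t where "t i = d / Suc i" for i
  have t: "t i > 0" "t i \<le> d" for i using d by (auto simp: t_def divide_le_eq)
  have t0: "t \<longlonglongrightarrow> 0"
    unfolding t_def by (rule LIMSEQ_Suc[OF lim_const_over_n])
  have "(\<lambda>i. LINT y|lborel. ?k (t i) y) \<longlonglongrightarrow> (LINT y :: real ^ 'n|lborel. (0 :: real))"
  proof (rule integral_dominated_convergence[where w = "?k d"])
    show "integrable lborel (?k d)" by (rule int)
    show "AE y in lborel. (\<lambda>i. ?k (t i) y) \<longlonglongrightarrow> 0"
    proof (rule AE_I2)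
      fix y :: "real ^ 'n"
      show "(\<lambda>i. ?k (t i) y) \<longlonglongrightarrow> 0"
      proof (cases "y = 0")
        case False
        then have "eventually (\<lambda>i. t i < norm y) sequentially"
          using t0 by (auto dest!: order_tendstoD(2)[of _ _ _ "norm y"])
        then have "eventually (\<lambda>i. ?k (t i) y = 0) sequentially"
          by eventually_elim auto
        then show ?thesis by (rule tendsto_eventually)
      qed simp
    qed
    show "AE y in lborel. norm (?k (t i) y) \<le> ?k d y" for i
      using t[of i] by (intro AE_I2) (auto simp: indicator_def)
  qed auto
  then have "eventually (\<lambda>i. (LINT y|lborel. ?k (t i) y) < \<epsilon> / 2) sequentially"
    using assms by (intro order_tendstoD(2)) auto
  then obtain i where i: "(LINT y|lborel. ?k (t i) y) < \<epsilon> / 2"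
    by (auto simp: eventually_sequentially)
  define s where "s = t i"
  have s: "s > 0" "s \<le> d" using t by (auto simp: s_def)
  have ints: "integrable lborel (?k s)"
    using s by (intro Bochner_Integration.integrable_bound[OF int]) (auto simp: indicator_def)
  have trans: "integrable lborel (\<lambda>y. ?k s (z - y)) \<and> (LINT y|lborel. ?k s (z - y)) < \<epsilon> / 2" for z
  proof -
    have i': "(LINT y|lborel. ?k s y) < \<epsilon> / 2" using i by (simp add: s_def)
    have D: "distr lborel borel ((+) (- z)) = (lborel :: (real ^ 'n) measure)" by (rule lborel_distr_plus)
    have k: "?k s (z - y) = ?k s (- z + y)" for y
      using norm_minus_commute[of z y] by (simp add: indicator_def)
    have "integrable (distr lborel borel ((+) (- z))) (?k s)" using ints by (simp only: D)
    then have "integrable lborel (\<lambda>y. ?k s (- z + y))"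
      by (subst (asm) integrable_distr_eq) auto
    moreover have "(LINT y|lborel. ?k s (- z + y)) = (LINT y|distr lborel borel ((+) (- z)). ?k s y)"
      by (subst integral_distr) auto
    ultimately show ?thesis unfolding k D using i' by simp
  qed
  have bound: "indicator E y * norm (z - y) powr (- \<gamma>) \<le> s powr (- \<gamma>) * indicator E y + ?k s (z - y)"
    for E and y z :: "real ^ 'n"
  proof (cases "norm (z - y) < s")
    case False
    then have "norm (z - y) powr (- \<gamma>) \<le> s powr (- \<gamma>)"
      using s gamma_pos by (intro powr_mono2') auto
    then show ?thesis by (simp add: indicator_def)
  qed (simp add: indicator_def)
  show ?thesis
  proof (rule that[of "\<epsilon> / 2 * s powr \<gamma>"])
    show "0 < \<epsilon> / 2 * s powr \<gamma>" using assms s by simp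
    fix z :: "real ^ 'n" and E :: "(real ^ 'n) set"
    assume E: "E \<in> fmeasurable lborel" and mE: "measure lborel E < \<epsilon> / 2 * s powr \<gamma>"
    have [measurable]: "E \<in> sets borel" using E by (auto simp: fmeasurable_def)
    have intE: "integrable lborel (indicat_real E)"
      using E by (intro integrable_real_indicator) (auto simp: fmeasurable_def)
    have intB: "integrable lborel (\<lambda>y. s powr (- \<gamma>) * indicator E y + ?k s (z - y))"
      using intE trans[of z] by simp
    have I: "integrable lborel (\<lambda>y. indicator E y * norm (z - y) powr (- \<gamma>))"
      by (rule Bochner_Integration.integrable_bound[OF intB], simp, rule AE_I2)
         (use bound[of E _ z] in \<open>force intro: order_trans[OF _ abs_ge_self]\<close>)
    have "(LINT y|lborel. indicator E y * norm (z - y) powr (- \<gamma>))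
        \<le> (LINT y|lborel. s powr (- \<gamma>) * indicator E y + ?k s (z - y))"
      using I intB bound by (intro integral_mono) auto
    also have "\<dots> = s powr (- \<gamma>) * measure lborel E + (LINT y|lborel. ?k s (z - y))"
      using intE trans[of z] by simp
    also have "\<dots> < s powr (- \<gamma>) * (\<epsilon> / 2 * s powr \<gamma>) + \<epsilon> / 2"
      using mE trans[of z] s by (intro add_strict_mono mult_strict_left_mono) auto
    also have "\<dots> = \<epsilon>" using s by (simp add: powr_minus field_simps)
    finally show "integrable lborel (\<lambda>y. indicator E y * norm (z - y) powr (- \<gamma>)) \<and>
       (LINT y|lborel. indicator E y * norm (z - y) powr (- \<gamma>)) < \<epsilon>" using I by simp
  qed
qed

text \<open>For \<open>l = 0\<close> the value is 0, because \<open>0 powr \<gamma> = 0\<close>;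
  this is where the moving spheres start.\<close>

definition kelvin :: "real ^ 'n \<Rightarrow> real \<Rightarrow> real ^ 'n \<Rightarrow> real" where
  "kelvin x l z = (l / norm (z - x)) powr \<gamma> * u (inversion x l z)"

end

lemma AE_not_sphere: "AE y :: 'a::euclidean_space in lborel. norm (y - x) \<noteq> r"
proof -
  have "sphere x r \<in> sets lborel" by simp
  then have "sphere x r \<in> null_sets lborel"
    using negligible_sphere[of x r] by (auto simp: negligible_iff_null_sets null_sets_def)
  then have "AE y in lborel. y \<notin> sphere x r" by (rule AE_not_in)
  then show ?thesis by eventually_elim (auto simp: dist_norm norm_minus_commute)
qed

lemma powr_diff_le:
  fixes a b S p :: real
  assumes "0 < b" "b < a" "a \<le> S" "p > 1"
  shows "a powr p - b powr p \<le> p * S powr (p - 1) * (a - b)"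
proof -
  have "\<exists>t>b. t < a \<and> a powr p - b powr p = (a - b) * (p * t powr (p - 1))"
    using assms by (intro MVT2) (auto intro!: derivative_eq_intros)
  then obtain t where t: "b < t" "t < a" "a powr p - b powr p = (a - b) * (p * t powr (p - 1))"
    by blast
  have "t powr (p - 1) \<le> S powr (p - 1)" using t assms by (intro powr_mono2) auto
  then have "(a - b) * (p * t powr (p - 1)) \<le> (a - b) * (p * S powr (p - 1))"
    using assms by (intro mult_left_mono) auto
  then show ?thesis using t by (simp add: mult_ac)
qed

section \<open>Moving spheres\<close>

text \<open>The setting for spheres around one center x of radius up to L. By
  \<open>small_far\<close> the Kelvin transform is at most c/2 at distance r or more from x. By
  \<open>small_annulus\<close> the inverted mass, which is at most
  \<open>L powr \<gamma> * S\<close>, weighted by the constant of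
  \<open>kernel_difference_far\<close>, is less than a surplus of c^p - (c/2)^p on a ball of radius
  1/8, which fits in the annulus.\<close>

locale moving_sphere = integral_solution \<sigma> \<Sigma> h u
  for \<sigma> and \<Sigma> :: "(real ^ 'n) set" and h u +
  fixes x :: "real ^ 'n" and L S c r :: real
  assumes x_norm: "norm x \<le> 3 / 2"
    and L_pos: "0 < L" and L_less: "L < r" and r_less: "r < 1 / 8"
    and cball_sub: "cball x L \<subseteq> \<Omega>" and u_le_S: "\<And>y. y \<in> cball x L \<Longrightarrow> u y \<le> S"
    and c_pos: "0 < c" and c_le_u: "\<And>z. z \<in> \<Omega> \<Longrightarrow> c \<le> u z"
    and h_kelvin: "\<And>l z. 0 < l \<Longrightarrow> l < norm (z - x) \<Longrightarrow> norm (z - x) < r \<Longrightarrow>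
       (l / norm (z - x)) powr \<gamma> * h (inversion x l z) \<le> h z"
    and small_far: "L powr \<gamma> * S \<le> c / 2 * r powr \<gamma>"
    and small_annulus: "12 * 16 powr (\<gamma> / 2) * (L powr \<gamma> * S)
       < (c powr p - (c / 2) powr p) * measure lborel (ball (0 :: real ^ 'n) (1 / 8))"
begin

text \<open>For \<open>y\<close> outside the sphere, \<open>fk l y\<close> is the \<open>p\<close>-th power of the Kelvin transform, and \<open>kr\<close>
  is the kernel \<open>norm (z - y) powr (- \<gamma>)\<close> reflected in either of its arguments.\<close>

abbreviation "Out l \<equiv> {y. l < norm (y - x)}"
definition "fk l y = (l / norm (y - x)) powr (\<gamma> * p) * f (inversion x l y)"
definition "kr l z y = (l / norm (z - x)) powr \<gamma> * norm (inversion x l z - y) powr (- \<gamma>)"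
definition "bad l = {z \<in> \<Omega>. l < norm (z - x) \<and> u z < kelvin x l z}"

lemma inversion_in_cball:
  assumes "0 \<le> l" "l \<le> L" "l < norm (z - x)"
  shows "inversion x l z \<in> cball x L"
proof -
  have "l\<^sup>2 \<le> l * norm (z - x)"
    using assms by (simp add: power2_eq_square mult_left_mono)
  then have "norm (inversion x l z - x) \<le> l"
    using assms by (simp add: norm_inversion divide_le_eq)
  then show ?thesis using assms by (simp add: dist_norm norm_minus_commute)
qed

lemma inversion_in_\<Omega>:
  assumes "0 \<le> l" "l \<le> L" "l < norm (z - x)"
  shows "inversion x l z \<in> \<Omega>"
  using inversion_in_cball[OF assms] cball_sub by blast

lemma x_in_\<Omega>: "x \<in> \<Omega>"
  using cball_sub L_pos by auto

lemma S_pos: "S > 0"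
  using u_le_S[of x] u_pos'[OF x_in_\<Omega>] L_pos by force

lemma kelvin_nonneg:
  assumes "0 \<le> l" "l \<le> L" "l < norm (z - x)"
  shows "0 \<le> kelvin x l z"
  using u_pos'[OF inversion_in_\<Omega>[OF assms]] by (simp add: kelvin_def)

lemma kelvin_le_S:
  assumes "0 \<le> l" "l \<le> L" "l < norm (z - x)"
  shows "kelvin x l z \<le> S"
proof -
  have "(l / norm (z - x)) powr \<gamma> \<le> 1"
    using assms gamma_pos powr_mono2[of \<gamma> "l / norm (z - x)" 1] by (simp add: divide_le_eq_1)
  then have "kelvin x l z \<le> 1 * S"
    unfolding kelvin_def using u_le_S[OF inversion_in_cball[OF assms]] u_pos'[OF inversion_in_\<Omega>[OF assms]]
    by (intro mult_mono) auto
  then show ?thesis by simp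
qed

text \<open>As u >= c, this confines \<open>bad l\<close> to distances less than r from x, where the
  inequality for h is available, and it leaves a surplus of mass in the annulus.\<close>

lemma kelvin_far:
  assumes "0 \<le> l" "l \<le> L" "r \<le> norm (z - x)"
  shows "kelvin x l z \<le> c / 2"
proof -
  have lz: "l < norm (z - x)" using assms L_less by simp
  have r0: "r > 0" using L_pos L_less by simp
  have "(l / norm (z - x)) powr \<gamma> \<le> (L / r) powr \<gamma>"
    using assms gamma_pos r0 by (intro powr_mono2 frac_le) auto
  then have "kelvin x l z \<le> (L / r) powr \<gamma> * S"
    unfolding kelvin_def
    using u_le_S[OF inversion_in_cball[OF assms(1,2) lz]] u_pos'[OF inversion_in_\<Omega>[OF assms(1,2) lz]]
    by (intro mult_mono) auto
  also have "\<dots> = L powr \<gamma> * S / r powr \<gamma>" using L_pos r0 by (simp add: powr_divide)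
  also have "\<dots> \<le> c / 2" using small_far r0 by (simp add: divide_le_eq)
  finally show ?thesis .
qed

section \<open>Transformation rules for the inverted density and the kernels\<close>

lemma fk_measurable [measurable]: "fk l \<in> borel_measurable borel"
  unfolding fk_def by measurable

lemma fk_nonneg: "0 \<le> fk l y"
  using f_nonneg by (simp add: fk_def)

lemma kr_measurable [measurable]: "kr l z \<in> borel_measurable borel"
  unfolding kr_def by measurable

lemma kr_nonneg: "0 \<le> kr l z y"
  by (simp add: kr_def)

lemma fk_eq_kelvin:
  assumes "0 < l" "l \<le> L" "l < norm (y - x)"
  shows "fk l y = kelvin x l y powr p"
proof -
  have "u (inversion x l y) > 0" using u_pos' inversion_in_\<Omega> assms by simp
  then show ?thesis
    using assms inversion_in_\<Omega>[of l y]
    by (simp add: fk_def kelvin_def f_\<Omega> powr_mult powr_powr)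
qed

text \<open>Conformal invariance of the equation: (n + 2 \<sigma>) + (n - 2 \<sigma>) = 2 n, so the
  Jacobian of the inversion splits into the weight in \<open>fk\<close> and a weight for the
  kernel.\<close>

lemma power_2n: "a > 0 \<Longrightarrow> a ^ (2 * CARD('n)) = a powr (\<gamma> * p + \<gamma>)" for a :: real
  using powr_realpow[of a "2 * CARD('n)"] by (simp add: gamma_p) (simp add: \<gamma>_def)

text \<open>This lemma and the next two transform the integrand of the equation at a point w over
  the inner ball, for w the reflection of z, w = z and w = x. Here the reflected points z', y'
  satisfy |z' - y'| = l^2 |z - y| / (|z - x| |y - x|), and the weights cancel.\<close>

lemma fk_kernel:
  assumes "0 < l" "l < norm (z - x)" "l < norm (y - x)"
  shows "(l / norm (z - x)) powr \<gamma> *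
      ((l / norm (y - x)) ^ (2 * CARD('n)) * (f (inversion x l y) * norm (inversion x l z - inversion x l y) powr (- \<gamma>)))
    = fk l y * norm (z - y) powr (- \<gamma>)"
proof -
  let ?s = "norm (z - x)" and ?r = "norm (y - x)"
  have s: "?s > 0" "?r > 0" using assms by linarith+
  have ne: "z \<noteq> x" "y \<noteq> x" using s by auto
  have "?s * norm (inversion x l z - inversion x l y) = l\<^sup>2 / ?r * norm (z - y)"
    using norm_inversion_commute[OF inversion_neq_center[OF \<open>0 < l\<close> ne(2)] ne(1), of l] inversion_inversion[OF \<open>0 < l\<close> ne(2)]
    by (simp add: norm_inversion norm_minus_commute[of y z])
  then have "norm (inversion x l z - inversion x l y) = (l / ?s) * (l / ?r) * norm (z - y)"
    using s by (simp add: field_simps power2_eq_square)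
  then have N: "norm (inversion x l z - inversion x l y) powr (- \<gamma>)
      = (l / ?s) powr (- \<gamma>) * (l / ?r) powr (- \<gamma>) * norm (z - y) powr (- \<gamma>)"
    using s assms by (simp only: powr_mult)
  have P: "(l / ?r) ^ (2 * CARD('n)) = (l / ?r) powr (\<gamma> * p) * (l / ?r) powr \<gamma>"
    using s assms by (subst power_2n) (auto simp: powr_add)
  have I: "a powr \<gamma> * a powr (- \<gamma>) = 1" if "a > 0" for a :: real
    using that by (simp add: powr_minus)
  have "(l / ?s) powr \<gamma> * ((l / ?r) ^ (2 * CARD('n)) * (f (inversion x l y) * norm (inversion x l z - inversion x l y) powr (- \<gamma>)))
    = ((l / ?s) powr \<gamma> * (l / ?s) powr (- \<gamma>)) * ((l / ?r) powr \<gamma> * (l / ?r) powr (- \<gamma>)) * (fk l y * norm (z - y) powr (- \<gamma>))"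
    unfolding N P fk_def by (simp only: ac_simps)
  then show ?thesis using s assms by (simp add: I)
qed

text \<open>By \<open>norm_inversion_commute\<close> the reflection passes from y to z, which
  produces \<open>kr\<close>.\<close>

lemma fk_reflected_kernel:
  assumes "0 < l" "l < norm (z - x)" "l < norm (y - x)"
  shows "(l / norm (y - x)) ^ (2 * CARD('n)) * (f (inversion x l y) * norm (z - inversion x l y) powr (- \<gamma>))
    = fk l y * kr l z y"
proof -
  let ?s = "norm (z - x)" and ?r = "norm (y - x)"
  have s: "?s > 0" "?r > 0" using assms by linarith+
  have ne: "z \<noteq> x" "y \<noteq> x" using s by auto
  have "?s * norm (inversion x l z - y) = ?r * norm (z - inversion x l y)"
    using norm_inversion_commute[OF ne(2,1), of l] by (simp add: norm_minus_commute)
  then have "norm (z - inversion x l y) = (?s / ?r) * norm (inversion x l z - y)"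
    using s by (simp add: field_simps)
  then have N: "norm (z - inversion x l y) powr (- \<gamma>) = (?s / ?r) powr (- \<gamma>) * norm (inversion x l z - y) powr (- \<gamma>)"
    by (simp only: powr_mult)
  have P: "(l / ?r) ^ (2 * CARD('n)) = (l / ?r) powr (\<gamma> * p) * (l / ?r) powr \<gamma>"
    using s assms by (subst power_2n) (auto simp: powr_add)
  have "(l / ?r) powr \<gamma> * (?s / ?r) powr (- \<gamma>) = (l / ?s) powr \<gamma>"
    using s assms by (simp add: powr_minus powr_divide)
  then have "(l / ?r) powr (\<gamma> * p) * f (inversion x l y) * ((l / ?r) powr \<gamma> * (?s / ?r) powr (- \<gamma>)) * norm (inversion x l z - y) powr (- \<gamma>)
     = fk l y * kr l z y"
    by (simp add: fk_def kr_def)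
  then show ?thesis unfolding N P by (simp only: ac_simps)
qed

text \<open>The reflected point has distance l^2 / |y - x| from x, so the kernel cancels the second
  factor of the Jacobian and only mass remains.\<close>

lemma fk_center:
  assumes "0 < l" "l < norm (y - x)"
  shows "l powr \<gamma> * ((l / norm (y - x)) ^ (2 * CARD('n)) * (f (inversion x l y) * norm (x - inversion x l y) powr (- \<gamma>)))
    = fk l y"
proof -
  let ?r = "norm (y - x)"
  have r: "?r > 0" using assms by linarith
  have "norm (x - inversion x l y) = l * (l / ?r)"
    using norm_inversion[of x l y] by (simp add: norm_minus_commute power2_eq_square)
  then have N: "norm (x - inversion x l y) powr (- \<gamma>) = l powr (- \<gamma>) * (l / ?r) powr (- \<gamma>)"
    by (simp only: powr_mult)
  have P: "(l / ?r) ^ (2 * CARD('n)) = (l / ?r) powr (\<gamma> * p) * (l / ?r) powr \<gamma>"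
    using r assms by (subst power_2n) (auto simp: powr_add)
  have I: "a powr \<gamma> * a powr (- \<gamma>) = 1" if "a > 0" for a :: real
    using that by (simp add: powr_minus)
  have "l powr \<gamma> * ((l / ?r) ^ (2 * CARD('n)) * (f (inversion x l y) * norm (x - inversion x l y) powr (- \<gamma>)))
     = (l powr \<gamma> * l powr (- \<gamma>)) * ((l / ?r) powr \<gamma> * (l / ?r) powr (- \<gamma>)) * fk l y"
    unfolding N P fk_def by (simp only: ac_simps)
  then show ?thesis using r assms by (simp add: I)
qed

section \<open>The integral formula for the difference of the Kelvin transform and the
  solution\<close>

lemma inversion_integral:
  assumes "0 < l" "w \<in> \<Omega>"
  shows "integrable lborel (\<lambda>y. indicator (Out l) y *
      ((l / norm (y - x)) ^ (2 * CARD('n)) * (f (inversion x l y) * norm (w - inversion x l y) powr (- \<gamma>))))"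
    and "(LINT y|lborel. indicator (Out l) y *
      ((l / norm (y - x)) ^ (2 * CARD('n)) * (f (inversion x l y) * norm (w - inversion x l y) powr (- \<gamma>))))
     = (LINT y|lborel. indicator (ball x l) y * (f y * norm (w - y) powr (- \<gamma>)))"
proof -
  have [measurable]: "ball x l \<in> sets borel" by simp
  have int: "integrable lborel (\<lambda>y. indicator (ball x l) y * (f y * norm (w - y) powr (- \<gamma>)))"
    by (rule Bochner_Integration.integrable_bound[OF integrable_f_kernel[OF assms(2)]])
       (auto simp: indicator_def)
  note cov = inversion_change_of_variables[OF assms(1), of "\<lambda>y. f y * norm (w - y) powr (- \<gamma>)" x, OF _ int]
  show "integrable lborel (\<lambda>y. indicator (Out l) y *
      ((l / norm (y - x)) ^ (2 * CARD('n)) * (f (inversion x l y) * norm (w - inversion x l y) powr (- \<gamma>))))"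
    by (rule cov(1)) measurable
  show "(LINT y|lborel. indicator (Out l) y *
      ((l / norm (y - x)) ^ (2 * CARD('n)) * (f (inversion x l y) * norm (w - inversion x l y) powr (- \<gamma>))))
     = (LINT y|lborel. indicator (ball x l) y * (f y * norm (w - y) powr (- \<gamma>)))"
    by (rule cov(2)) measurable
qed

lemma integral_split:
  assumes "w \<in> \<Omega>"
  shows "(LINT y|lborel. f y * norm (w - y) powr (- \<gamma>)) =
      (LINT y|lborel. indicator (ball x l) y * (f y * norm (w - y) powr (- \<gamma>)))
    + (LINT y|lborel. indicator (Out l) y * (f y * norm (w - y) powr (- \<gamma>)))"
    and "integrable lborel (\<lambda>y. indicator (Out l) y * (f y * norm (w - y) powr (- \<gamma>)))"
proof -
  let ?G = "\<lambda>y. f y * norm (w - y) powr (- \<gamma>)"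
  have [measurable]: "ball x l \<in> sets borel" by simp
  have 1: "integrable lborel (\<lambda>y. indicator (ball x l) y * ?G y)"
    by (rule Bochner_Integration.integrable_bound[OF integrable_f_kernel[OF assms]])
       (auto simp: indicator_def)
  show 2: "integrable lborel (\<lambda>y. indicator (Out l) y * ?G y)"
    by (rule Bochner_Integration.integrable_bound[OF integrable_f_kernel[OF assms]])
       (auto simp: indicator_def)
  have "(LINT y|lborel. ?G y) = (LINT y|lborel. indicator (ball x l) y * ?G y + indicator (Out l) y * ?G y)"
  proof (rule integral_cong_AE)
    show "AE y in lborel. ?G y = indicator (ball x l) y * ?G y + indicator (Out l) y * ?G y"
      using AE_not_sphere[of x l]
      by eventually_elim (auto simp: indicator_def dist_norm norm_minus_commute)
  qed measurable
  then show "(LINT y|lborel. ?G y) = (LINT y|lborel. indicator (ball x l) y * ?G y)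
     + (LINT y|lborel. indicator (Out l) y * ?G y)"
    using 1 2 by simp
qed

text \<open>Split the equations at z and at its reflection along the sphere and invert the inner
  parts. The four exterior integrals, of \<open>fk\<close> and \<open>f\<close> against the two
  kernels, combine into a product of differences. The kernel factor is nonnegative outside the
  sphere, so only the places with \<open>fk\<close> above \<open>f\<close> are harmful.\<close>

lemma kelvin_difference:
  assumes l: "0 < l" "l \<le> L" and z: "z \<in> \<Omega>" "l < norm (z - x)"
  shows "integrable lborel (\<lambda>y. indicator (Out l) y * (fk l y * norm (z - y) powr (- \<gamma>)))" (is ?A)
    and "integrable lborel (\<lambda>y. indicator (Out l) y * ((fk l y - f y) * (norm (z - y) powr (- \<gamma>) - kr l z y)))" (is ?B)
    and "kelvin x l z - u z =
      (LINT y|lborel. indicator (Out l) y * ((fk l y - f y) * (norm (z - y) powr (- \<gamma>) - kr l z y)))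
      + ((l / norm (z - x)) powr \<gamma> * h (inversion x l z) - h z)" (is ?C)
proof -
  let ?k = "\<lambda>y. norm (z - y) powr (- \<gamma>)" and ?a = "(l / norm (z - x)) powr \<gamma>"
  let ?w = "inversion x l z"
  have w: "?w \<in> \<Omega>" using inversion_in_\<Omega> l z by simp
  have e1: "?a * (indicator (Out l) y *
      ((l / norm (y - x)) ^ (2 * CARD('n)) * (f (inversion x l y) * norm (?w - inversion x l y) powr (- \<gamma>))))
      = indicator (Out l) y * (fk l y * ?k y)" for y
    using fk_kernel[OF l(1) z(2), of y] by (auto simp: indicator_def)
  have e2: "indicator (Out l) y *
      ((l / norm (y - x)) ^ (2 * CARD('n)) * (f (inversion x l y) * norm (z - inversion x l y) powr (- \<gamma>)))
      = indicator (Out l) y * (fk l y * kr l z y)" for y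
    using fk_reflected_kernel[OF l(1) z(2), of y] by (auto simp: indicator_def)
  have e3: "?a * (indicator (Out l) y * (f y * norm (?w - y) powr (- \<gamma>))) = indicator (Out l) y * (f y * kr l z y)" for y
    by (simp add: kr_def)
  have i1: "integrable lborel (\<lambda>y. indicator (Out l) y * (fk l y * ?k y))"
    using integrable_mult_right[OF inversion_integral(1)[OF l(1) w], of ?a] unfolding e1 .
  have i2: "integrable lborel (\<lambda>y. indicator (Out l) y * (fk l y * kr l z y))"
    using inversion_integral(1)[OF l(1) z(1)] unfolding e2 .
  have i3: "integrable lborel (\<lambda>y. indicator (Out l) y * (f y * kr l z y))"
    using integrable_mult_right[OF integral_split(2)[OF w], of ?a l] unfolding e3 .
  have i4: "integrable lborel (\<lambda>y. indicator (Out l) y * (f y * ?k y))"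
    by (rule integral_split(2)[OF z(1)])
  show ?A by (rule i1)
  have eq: "indicator (Out l) y * ((fk l y - f y) * (?k y - kr l z y)) =
      (indicator (Out l) y * (fk l y * ?k y) + indicator (Out l) y * (f y * kr l z y))
      - (indicator (Out l) y * (fk l y * kr l z y) + indicator (Out l) y * (f y * ?k y))" for y
    by (simp add: algebra_simps)
  show ?B unfolding eq using i1 i2 i3 i4 by simp
  have "kelvin x l z = ?a * ((LINT y|lborel. f y * norm (?w - y) powr (- \<gamma>)) + h ?w)"
    unfolding kelvin_def integral_equation[OF w] ..
  also have "\<dots> = ?a * (LINT y|lborel. indicator (ball x l) y * (f y * norm (?w - y) powr (- \<gamma>)))
      + ?a * (LINT y|lborel. indicator (Out l) y * (f y * norm (?w - y) powr (- \<gamma>))) + ?a * h ?w"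
    unfolding integral_split(1)[OF w, of l] by (simp add: algebra_simps)
  also have "?a * (LINT y|lborel. indicator (ball x l) y * (f y * norm (?w - y) powr (- \<gamma>)))
      = (LINT y|lborel. indicator (Out l) y * (fk l y * ?k y))"
    unfolding inversion_integral(2)[OF l(1) w, symmetric] integral_mult_right_zero[symmetric] e1 ..
  also have "?a * (LINT y|lborel. indicator (Out l) y * (f y * norm (?w - y) powr (- \<gamma>)))
      = (LINT y|lborel. indicator (Out l) y * (f y * kr l z y))"
    unfolding integral_mult_right_zero[symmetric] e3 ..
  finally have K: "kelvin x l z = (LINT y|lborel. indicator (Out l) y * (fk l y * ?k y))
      + (LINT y|lborel. indicator (Out l) y * (f y * kr l z y)) + ?a * h ?w" .
  have "u z = (LINT y|lborel. indicator (Out l) y * (fk l y * kr l z y))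
      + (LINT y|lborel. indicator (Out l) y * (f y * ?k y)) + h z"
    unfolding integral_equation[OF z(1)] integral_split(1)[OF z(1), of l]
      inversion_integral(2)[OF l(1) z(1), symmetric] e2 ..
  then show ?C unfolding K eq using i1 i2 i3 i4 by simp
qed

text \<open>Inverted back, the exterior mass is l^\<gamma> times the part over
  \<open>ball x l\<close> of the integral in the equation at the center, hence at most l^\<gamma>
  u(x).\<close>

lemma fk_mass:
  assumes l: "0 < l" "l \<le> L"
  shows "integrable lborel (\<lambda>y. indicator (Out l) y * fk l y)"
    and "(LINT y|lborel. indicator (Out l) y * fk l y) \<le> L powr \<gamma> * S"
proof -
  have [measurable]: "ball x l \<in> sets borel" by simp
  have e: "l powr \<gamma> * (indicator (Out l) y *
      ((l / norm (y - x)) ^ (2 * CARD('n)) * (f (inversion x l y) * norm (x - inversion x l y) powr (- \<gamma>))))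
      = indicator (Out l) y * fk l y" for y
    using fk_center[OF l(1), of y] by (auto simp: indicator_def)
  show "integrable lborel (\<lambda>y. indicator (Out l) y * fk l y)"
    using integrable_mult_right[OF inversion_integral(1)[OF l(1) x_in_\<Omega>], of "l powr \<gamma>"] unfolding e .
  have "(LINT y|lborel. indicator (Out l) y * fk l y)
      = l powr \<gamma> * (LINT y|lborel. indicator (ball x l) y * (f y * norm (x - y) powr (- \<gamma>)))"
    unfolding inversion_integral(2)[OF l(1) x_in_\<Omega>, symmetric] integral_mult_right_zero[symmetric] e ..
  also have "\<dots> \<le> L powr \<gamma> * S"
  proof (intro mult_mono)
    have "(LINT y|lborel. indicator (ball x l) y * (f y * norm (x - y) powr (- \<gamma>)))
        \<le> (LINT y|lborel. f y * norm (x - y) powr (- \<gamma>))"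
      by (intro integral_mono' integrable_f_kernel x_in_\<Omega>) (auto simp: indicator_def f_nonneg)
    also have "\<dots> \<le> u x"
      using integral_equation[OF x_in_\<Omega>] h_pos[of x] x_in_\<Omega> \<Omega>_subset by force
    also have "\<dots> \<le> S" using u_le_S L_pos by simp
    finally show "(LINT y|lborel. indicator (ball x l) y * (f y * norm (x - y) powr (- \<gamma>))) \<le> S" .
    show "l powr \<gamma> \<le> L powr \<gamma>" using l gamma_pos by (intro powr_mono2) auto
    show "0 \<le> (LINT y|lborel. indicator (ball x l) y * (f y * norm (x - y) powr (- \<gamma>)))"
      using f_nonneg by (intro integral_nonneg_AE) auto
  qed simp
  finally show "(LINT y|lborel. indicator (Out l) y * fk l y) \<le> L powr \<gamma> * S" .
qed

end

section \<open>The bad set and the continuation in the radius\<close>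

context moving_sphere
begin

lemma continuous_on_kelvin: "0 < l \<Longrightarrow> l \<le> L \<Longrightarrow> continuous_on (Out l) (kelvin x l)"
proof -
  assume l: "0 < l" "l \<le> L"
  have "continuous_on (Out l) (inversion x l)"
    unfolding inversion_def using l by (intro continuous_intros) auto
  then have "continuous_on (Out l) (\<lambda>z. u (inversion x l z))"
    by (rule continuous_on_compose2[OF continuous_on_u]) (use inversion_in_\<Omega> l in auto)
  then show ?thesis
    unfolding kelvin_def using l gamma_pos by (intro continuous_intros) auto
qed

lemma open_bad:
  assumes "0 < l" "l \<le> L"
  shows "open (bad l)"
proof -
  have Out: "open (Out l)" by (intro open_Collect_less continuous_intros)
  have "continuous_on (\<Omega> \<inter> Out l) (\<lambda>z. kelvin x l z - u z)"
    by (intro continuous_on_diff continuous_on_subset[OF continuous_on_kelvin[OF assms]]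
        continuous_on_subset[OF continuous_on_u]) auto
  then have "open ((\<Omega> \<inter> Out l) \<inter> (\<lambda>z. kelvin x l z - u z) -` {0<..})"
    using open_\<Omega> Out by (intro continuous_open_preimage) auto
  also have "(\<Omega> \<inter> Out l) \<inter> (\<lambda>z. kelvin x l z - u z) -` {0<..} = bad l"
    by (auto simp: bad_def)
  finally show ?thesis .
qed

lemma bad_fmeasurable:
  assumes "0 < l" "l \<le> L"
  shows "bad l \<in> fmeasurable lborel"
proof -
  have "ball (0 :: real ^ 'n) 2 \<in> fmeasurable lborel"
    using emeasure_lborel_ball_finite[of "0 :: real ^ 'n" 2] by (auto simp: fmeasurable_def)
  moreover have "bad l \<subseteq> ball 0 2" using \<Omega>_subset by (auto simp: bad_def)
  moreover have "bad l \<in> sets lborel" using open_bad[OF assms] by simp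
  ultimately show ?thesis by (metis fmeasurableI2)
qed

lemma bad_near:
  assumes "0 \<le> l" "l \<le> L" "z \<in> bad l"
  shows "norm (z - x) < r"
  using kelvin_far[OF assms(1,2), of z] c_le_u[of z] c_pos assms(3) by (force simp: bad_def)

text \<open>The mass that the reflected solution puts outside the domain is beaten by the mass
  of the solution in a fixed ball inside the annulus around \<open>x\<close>.\<close>

lemma kelvin_difference_less:
  assumes l: "0 < l" "l \<le> L" and z: "z \<in> \<Omega>" "l < norm (z - x)" "norm (z - x) < r"
  shows "integrable lborel (\<lambda>y. indicator (bad l) y * ((fk l y - f y) * norm (z - y) powr (- \<gamma>)))" (is ?A)
    and "kelvin x l z - u z < (LINT y|lborel. indicator (bad l) y * ((fk l y - f y) * norm (z - y) powr (- \<gamma>)))" (is ?B)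
proof -
  let ?k = "\<lambda>y. norm (z - y) powr (- \<gamma>)"
  define \<tau> where "\<tau> = ((norm (z - x))\<^sup>2 - l\<^sup>2) / l\<^sup>2"
  \<comment> \<open>The common unit of gain and loss. It tends to 0 as z approaches the sphere, so
    it has to factor out of the comparison.\<close>
  define T where "T = 1 - (1 + \<tau> / 3) powr (- (\<gamma> / 2))"
  define C where "C = 12 * 16 powr (\<gamma> / 2)"
  define c1 where "c1 = c powr p - (c / 2) powr p"
  have q: "\<gamma> / 2 > 0" and g2: "2 * (\<gamma> / 2) = \<gamma>" using gamma_pos by auto
  have r8: "norm (z - x) < 1 / 8" using z r_less by simp
  have "l\<^sup>2 < (norm (z - x))\<^sup>2" using l z by (simp add: power_strict_mono)
  then have "\<tau> > 0" using l by (simp add: \<tau>_def)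
  then have "(1 + \<tau> / 3) powr (- (\<gamma> / 2)) < 1"
    using q powr_less_mono2_neg[of "- (\<gamma> / 2)" 1 "1 + \<tau> / 3"] by simp
  then have T: "T > 0" by (simp add: T_def)
  have c1: "c1 > 0" using c_pos p_gt_1 by (simp add: c1_def powr_less_mono2)
  obtain e :: "real ^ 'n" where e: "norm e = 1" using vector_choose_size[of 1] by auto
  \<comment> \<open>A ball inside the annulus 1/4 < |y - x| < 1/2, hence inside B_2 and disjoint
    from the bad set, which stays within 1/8 of x.\<close>
  define B where "B = ball (x + (3 / 8) *\<^sub>R e) (1 / 8)"
  have B_meas [measurable]: "B \<in> sets borel" by (simp add: B_def)
  have mB: "measure lborel B = measure lborel (ball (0 :: real ^ 'n) (1 / 8))"
    unfolding B_def by (simp add: content_ball)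
  have B: "1 / 4 < norm (y - x) \<and> norm (y - x) < 1 / 2" if "y \<in> B" for y
  proof -
    have *: "norm (y - x - (3 / 8) *\<^sub>R e) < 1 / 8"
      using that by (simp add: B_def dist_norm norm_minus_commute algebra_simps)
    have "norm (y - x) \<le> norm (y - x - (3 / 8) *\<^sub>R e) + norm ((3 / 8) *\<^sub>R e)"
      using norm_triangle_ineq[of "y - x - (3 / 8) *\<^sub>R e" "(3 / 8) *\<^sub>R e"] by simp
    moreover have "norm ((3 / 8) *\<^sub>R e) \<le> norm (y - x - (3 / 8) *\<^sub>R e) + norm (y - x)"
      using norm_triangle_ineq4[of "y - x" "y - x - (3 / 8) *\<^sub>R e"] by simp
    ultimately show ?thesis using * e by simp
  qed
  have near: "y \<in> ball 0 2" if "norm (y - x) < 1 / 2" for y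
    using that x_norm norm_triangle_ineq[of x "y - x"] by simp
  have bad_meas [measurable]: "bad l \<in> sets borel" using open_bad[OF l] by simp
  have bad_sub: "bad l \<subseteq> Out l" by (auto simp: bad_def)
  have fk_bad: "f y < fk l y" if "y \<in> bad l" for y
    using that fk_eq_kelvin[OF l, of y] u_pos'[of y] p_gt_1
    by (auto simp: bad_def f_\<Omega> intro!: powr_less_mono2)
  show A: ?A
  proof (rule Bochner_Integration.integrable_bound[OF kelvin_difference(1)[OF l z(1,2)]])
    show "AE y in lborel. norm (indicator (bad l) y * ((fk l y - f y) * ?k y))
        \<le> norm (indicator (Out l) y * (fk l y * ?k y))"
    proof (intro AE_I2)
      fix y
      show "norm (indicator (bad l) y * ((fk l y - f y) * ?k y)) \<le> norm (indicator (Out l) y * (fk l y * ?k y))"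
      proof (cases "y \<in> bad l")
        case True
        then have "\<bar>fk l y - f y\<bar> \<le> \<bar>fk l y\<bar>" using fk_bad[OF True] f_nonneg[of y] by simp
        moreover have "l < norm (y - x)" using True bad_sub by blast
        ultimately show ?thesis using True by (simp add: abs_mult mult_right_mono)
      qed simp
    qed
  qed measurable
  have intB: "integrable lborel (indicat_real B)"
    unfolding B_def using emeasure_lborel_ball_finite[of "x + (3 / 8) *\<^sub>R e" "1 / 8"]
    by (intro integrable_real_indicator) auto
  \<comment> \<open>A majorant of the integrand: on the bad set \<open>kr\<close> is dropped, the
    loss outside \<Omega> is charged on the whole exterior, where \<open>fk_mass\<close> controls
    it, and the surplus on \<open>B\<close> is credited. Elsewhere the integrand is
    nonpositive.\<close>
  define R where "R y = indicator (bad l) y * ((fk l y - f y) * ?k y)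
      + T * (C * (indicator (Out l) y * fk l y) - c1 * indicator B y)" for y
  have R: "integrable lborel R"
    unfolding R_def using A fk_mass(1)[OF l] intB by simp
  have "AE y in lborel. indicator (Out l) y * ((fk l y - f y) * (?k y - kr l z y)) \<le> R y"
    using AE_\<Omega> AE_lborel_singleton[of z]
  proof eventually_elim
    case (elim y)
    show ?case
    proof (cases "l < norm (y - x)")
      case False
      then have "y \<notin> B" using B[of y] l L_less r_less by auto
      moreover have "y \<notin> bad l" using False bad_sub by auto
      ultimately show ?thesis using False by (simp add: R_def)
    next
      case out: True
      have kr: "kr l z y \<le> ?k y"
        using reflected_kernel_le[OF l(1) z(2) out elim(2) q] unfolding g2 kr_def .
      show ?thesis
      proof (cases "y \<in> \<Omega>")
        case False
        \<comment> \<open>Almost every point off \<Omega> lies outside B_2, while |x| <=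
          3/2.\<close>
        then have far: "1 / 2 \<le> norm (y - x)" using elim near by force
        have fy: "f y = 0" using False by (simp add: f_def)
        have "?k y - kr l z y \<le> C * T"
          using kernel_difference_far[OF l(1) z(2) r8 far q \<tau>_def] unfolding g2 kr_def C_def T_def .
        then have "fk l y * (?k y - kr l z y) \<le> fk l y * (C * T)"
          using fk_nonneg by (rule mult_left_mono)
        moreover have "y \<notin> B" using B far by force
        moreover have "y \<notin> bad l" using False by (simp add: bad_def)
        ultimately show ?thesis using out fy by (simp add: R_def mult_ac)
      next
        case True
        have pos: "0 \<le> T * (C * fk l y)" using T fk_nonneg by (simp add: C_def)
        show ?thesis
        proof (cases "y \<in> bad l")
          case bad: True
          have "norm (y - x) < 1 / 8" using bad_near[of l y] bad l r_less by simp
          then have "y \<notin> B" using B by force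
          moreover have "(fk l y - f y) * (?k y - kr l z y) \<le> (fk l y - f y) * ?k y"
            using fk_bad[OF bad] kr_nonneg[of l z y] by (intro mult_left_mono) auto
          ultimately show ?thesis using pos out bad by (simp add: R_def)
        next
          case False
          have kelvin_le: "kelvin x l y \<le> u y" using False True out by (auto simp: bad_def)
          have le: "fk l y \<le> f y"
            using kelvin_le kelvin_nonneg[of l y] l out p_gt_1 True
            by (simp add: fk_eq_kelvin f_\<Omega> powr_mono2)
          show ?thesis
          proof (cases "y \<in> B")
            case yB: True
            have "kelvin x l y \<le> c / 2"
              using B[OF yB] r_less l by (intro kelvin_far) auto
            then have "fk l y \<le> (c / 2) powr p"
              using kelvin_nonneg[of l y] l out p_gt_1 by (simp add: fk_eq_kelvin powr_mono2)
            moreover have "c powr p \<le> f y"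
              using c_le_u[OF True] c_pos p_gt_1 True by (simp add: f_\<Omega> powr_mono2)
            ultimately have "c1 \<le> f y - fk l y" by (simp add: c1_def)
            moreover have "T \<le> ?k y - kr l z y"
              using kernel_difference_annulus[OF l(1) z(2) r8 _ _ q \<tau>_def, of y] B[OF yB]
              unfolding g2 kr_def T_def by simp
            ultimately have "c1 * T \<le> (f y - fk l y) * (?k y - kr l z y)"
              using c1 T by (intro mult_mono) auto
            then show ?thesis using pos out False yB by (simp add: R_def algebra_simps)
          next
            case notB: False
            have "(fk l y - f y) * (?k y - kr l z y) \<le> 0"
              using le kr by (intro mult_nonpos_nonneg) auto
            then show ?thesis using pos out False notB by (simp add: R_def)
          qed
        qed
      qed
    qed
  qed
  then have "(LINT y|lborel. indicator (Out l) y * ((fk l y - f y) * (?k y - kr l z y))) \<le> (LINT y|lborel. R y)"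
    by (intro integral_mono_AE kelvin_difference(2)[OF l z(1,2)] R)
  also have "(LINT y|lborel. R y) = (LINT y|lborel. indicator (bad l) y * ((fk l y - f y) * ?k y))
      + T * (C * (LINT y|lborel. indicator (Out l) y * fk l y) - c1 * measure lborel B)"
    unfolding R_def using A fk_mass(1)[OF l] intB by simp
  also have "\<dots> < (LINT y|lborel. indicator (bad l) y * ((fk l y - f y) * ?k y))"
  proof -
    have "C * (LINT y|lborel. indicator (Out l) y * fk l y) \<le> C * (L powr \<gamma> * S)"
      using fk_mass(2)[OF l] by (intro mult_left_mono) (auto simp: C_def)
    also have "\<dots> < c1 * measure lborel B"
      using small_annulus unfolding C_def c1_def mB .
    finally show ?thesis using T by (simp add: mult_pos_neg)
  qed
  finally have "(LINT y|lborel. indicator (Out l) y * ((fk l y - f y) * (?k y - kr l z y)))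
      < (LINT y|lborel. indicator (bad l) y * ((fk l y - f y) * ?k y))" .
  then show ?B
    using kelvin_difference(3)[OF l z(1,2)] h_kelvin[OF l(1) z(2,3)] by linarith
qed

text \<open>The substitute for the strong maximum principle: for an empty bad set the right-hand
  side in \<open>kelvin_difference_less\<close> is 0, and the inequality there is strict.\<close>

lemma kelvin_less:
  assumes "0 \<le> l" "l \<le> L" "bad l = {}" and z: "z \<in> \<Omega>" "l < norm (z - x)"
  shows "kelvin x l z < u z"
proof (cases "l = 0")
  case True
  then show ?thesis using u_pos'[OF z(1)] by (simp add: kelvin_def)
next
  case False
  show ?thesis
  proof (cases "norm (z - x) < r")
    case True
    then show ?thesis
      using kelvin_difference_less(2)[of l z] assms False by simp
  next
    case far: False
    then show ?thesis using kelvin_far[of l z] c_le_u[OF z(1)] c_pos assms by force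
  qed
qed

text \<open>The maximum of \<open>kelvin x l - u\<close> over the bad set is at most half of itself once that set is small.\<close>

lemma bad_empty_if_small:
  obtains \<delta> where "\<delta> > 0"
    "\<And>l. 0 < l \<Longrightarrow> l \<le> L \<Longrightarrow> measure lborel (bad l) < \<delta> \<Longrightarrow> bad l = {}"
proof -
  \<comment> \<open>A Lipschitz constant of the p-th power on values up to \<open>S\<close>, which
    bounds the Kelvin transform. Kernel integrals below \<open>1 / (2 * K)\<close> then give the
    contraction factor 1/2.\<close>
  define K where "K = p * S powr (p - 1)"
  have K: "K > 0" using p_gt_1 S_pos by (simp add: K_def)
  then have "1 / (2 * K) > 0" by simp
  then obtain \<delta> where \<delta>: "\<delta> > 0"
    "\<And>(z :: real ^ 'n) E. E \<in> fmeasurable lborel \<Longrightarrow> measure lborel E < \<delta> \<Longrightarrow>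
       integrable lborel (\<lambda>y. indicator E y * norm (z - y) powr (- \<gamma>)) \<and>
       (LINT y|lborel. indicator E y * norm (z - y) powr (- \<gamma>)) < 1 / (2 * K)"
    using kernel_small by blast
  show ?thesis
  proof (rule that[OF \<delta>(1)], rule ccontr)
    fix l assume l: "0 < l" "l \<le> L" and small: "measure lborel (bad l) < \<delta>" and ne: "bad l \<noteq> {}"
    let ?w = "\<lambda>z. kelvin x l z - u z"
    note small' = \<delta>(2)[OF bad_fmeasurable[OF l] small]
    have "?w z \<le> S" if "z \<in> bad l" for z
      using kelvin_le_S[of l z] u_pos'[of z] l that by (auto simp: bad_def)
    then have bdd: "bdd_above (?w ` bad l)" by (intro bdd_aboveI2)
    define m where "m = (SUP z\<in>bad l. ?w z)"
    have wm: "?w z \<le> m" if "z \<in> bad l" for z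
      unfolding m_def using bdd that by (rule cSUP_upper2[where x = z]) auto
    obtain z1 where z1: "z1 \<in> bad l" using ne by auto
    then have "?w z1 > 0" by (auto simp: bad_def)
    then have m: "m > 0" using wm[OF z1] by simp
    have "?w z \<le> m / 2" if z: "z \<in> bad l" for z
    proof -
      have z': "z \<in> \<Omega>" "l < norm (z - x)" "norm (z - x) < r"
        using z bad_near[of l z] l by (auto simp: bad_def)
      have "?w z < (LINT y|lborel. indicator (bad l) y * ((fk l y - f y) * norm (z - y) powr (- \<gamma>)))"
        by (rule kelvin_difference_less(2)[OF l z'])
      also have "\<dots> \<le> (LINT y|lborel. K * m * (indicator (bad l) y * norm (z - y) powr (- \<gamma>)))"
      proof (intro integral_mono kelvin_difference_less(1)[OF l z'] integrable_mult_right)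
        show "integrable lborel (\<lambda>y. indicator (bad l) y * norm (z - y) powr (- \<gamma>))"
          using small' by blast
        fix y
        show "indicator (bad l) y * ((fk l y - f y) * norm (z - y) powr (- \<gamma>))
            \<le> K * m * (indicator (bad l) y * norm (z - y) powr (- \<gamma>))"
        proof (cases "y \<in> bad l")
          case True
          then have y: "y \<in> \<Omega>" "l < norm (y - x)" "u y < kelvin x l y" by (auto simp: bad_def)
          have "fk l y - f y \<le> K * ?w y"
            unfolding K_def fk_eq_kelvin[OF l y(2)] f_\<Omega>[OF y(1)]
            using u_pos'[OF y(1)] y(3) kelvin_le_S[of l y] l y(2) p_gt_1 by (intro powr_diff_le) auto
          also have "\<dots> \<le> K * m" using wm[OF True] K by simp
          finally show ?thesis using True by (simp add: mult_right_mono)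
        qed simp
      qed
      also have "\<dots> = K * m * (LINT y|lborel. indicator (bad l) y * norm (z - y) powr (- \<gamma>))"
        by simp
      also have "\<dots> \<le> K * m * (1 / (2 * K))"
        using small'[of z] K m by (intro mult_left_mono) auto
      also have "\<dots> = m / 2" using K by simp
      finally show ?thesis by simp
    qed
    then have "m \<le> m / 2" unfolding m_def using ne by (intro cSUP_least)
    then show False using m by simp
  qed
qed

lemma tendsto_kelvin:
  assumes X: "X \<longlonglongrightarrow> l" "\<And>k. 0 \<le> X k" and l: "0 \<le> l" "l \<le> L" "l < norm (z - x)"
  shows "(\<lambda>k. kelvin x (X k) z) \<longlonglongrightarrow> kelvin x l z"
proof -
  have zx: "norm (z - x) \<noteq> 0" using l by auto
  have "isCont u (inversion x l z)"
    using continuous_on_u open_\<Omega> inversion_in_\<Omega>[OF l] by (simp add: continuous_on_eq_continuous_at)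
  moreover have "(\<lambda>k. inversion x (X k) z) \<longlonglongrightarrow> inversion x l z"
    unfolding inversion_def using X(1) zx by (intro tendsto_intros)
  ultimately have 1: "(\<lambda>k. u (inversion x (X k) z)) \<longlonglongrightarrow> u (inversion x l z)"
    by (rule isCont_tendsto_compose)
  have "(\<lambda>k. (X k / norm (z - x)) powr \<gamma>) \<longlonglongrightarrow> (l / norm (z - x)) powr \<gamma>"
  \<comment> \<open>The base may tend to 0, since \<open>l = 0\<close> is allowed; the exponent is
    positive.\<close>
  proof (rule tendsto_powr2)
    show "(\<lambda>k. X k / norm (z - x)) \<longlonglongrightarrow> l / norm (z - x)"
      using X(1) zx by (intro tendsto_intros)
    show "\<forall>\<^sub>F k in sequentially. 0 \<le> X k / norm (z - x)"
      using X(2) by (intro always_eventually) auto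
  qed (use gamma_pos in auto)
  then show ?thesis unfolding kelvin_def using 1 by (intro tendsto_mult)
qed

text \<open>Let l be the infimum of the radii with nonempty bad set. At l the bad set is empty by
  continuity in the radius. Along radii of \<open>N\<close> tending to l the bad sets lose almost
  every point, because the inequality at l is strict off the sphere; so their measures tend to 0,
  against \<open>bad_empty_if_small\<close>. The case l = 0 is covered, as the transform vanishes
  there.\<close>

lemma bad_empty:
  assumes "0 \<le> l0" "l0 \<le> L"
  shows "bad l0 = {}"
proof (rule ccontr)
  assume "bad l0 \<noteq> {}"
  define N where "N = {l. 0 \<le> l \<and> l \<le> L \<and> bad l \<noteq> {}}"
  have N: "N \<noteq> {}" "bdd_below N"
    using assms \<open>bad l0 \<noteq> {}\<close> by (auto simp: N_def intro!: bdd_belowI[of _ 0])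
  define l where "l = Inf N"
  have l: "0 \<le> l" "l \<le> L"
    using N unfolding l_def
    by (auto simp: N_def intro!: cInf_greatest intro: cInf_lower2)
  have good: "bad \<mu> = {}" if "0 \<le> \<mu>" "\<mu> < l" for \<mu>
    using that l cInf_lower[OF _ N(2), of \<mu>] by (force simp: N_def l_def)
  have bad_l: "bad l = {}"
  proof (rule ccontr)
    assume "bad l \<noteq> {}"
    then obtain z where z: "z \<in> \<Omega>" "l < norm (z - x)" "u z < kelvin x l z" by (auto simp: bad_def)
    \<comment> \<open>Approaches l strictly from below, where all bad sets are empty.\<close>
    define X where "X k = l * (1 - 1 / real (Suc k))" for k
    have "X \<longlonglongrightarrow> l * (1 - 0)"
      unfolding X_def by (intro tendsto_intros LIMSEQ_Suc[OF lim_const_over_n])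
    then have X: "X \<longlonglongrightarrow> l" by simp
    have l0: "l > 0"
    proof (rule ccontr)
      assume "\<not> l > 0"
      then have "l = 0" using l by simp
      then show False using z u_pos'[OF z(1)] by (simp add: kelvin_def)
    qed
    have X0: "0 \<le> X k" "X k < l" for k
      using l0 by (auto simp: X_def field_simps)
    have "kelvin x (X k) z \<le> u z" for k
    proof -
      have "z \<notin> bad (X k)" using good[OF X0, of k] by simp
      then show ?thesis using z X0(2)[of k] by (auto simp: bad_def)
    qed
    then have "kelvin x l z \<le> u z"
      using tendsto_kelvin[OF X X0(1) l z(2)] by (intro LIMSEQ_le_const2) auto
    then show False using z by simp
  qed
  have "\<exists>\<mu>\<in>N. \<mu> < l + 1 / real (Suc k)" for k
    using cInf_lessD[OF N(1), of "l + 1 / real (Suc k)"] by (auto simp: l_def)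
  then obtain X where X: "\<And>k. X k \<in> N" "\<And>k. X k < l + 1 / real (Suc k)" by metis
  have Xl: "l \<le> X k" for k unfolding l_def using X(1) N(2) by (rule cInf_lower)
  have X0: "0 < X k" "X k \<le> L" for k
  proof -
    have "X k \<noteq> l" using X(1)[of k] bad_l by (auto simp: N_def)
    then show "0 < X k" "X k \<le> L" using Xl[of k] l X(1)[of k] by (auto simp: N_def)
  qed
  have lim: "X \<longlonglongrightarrow> l"
  proof (rule tendsto_sandwich[of "\<lambda>_. l" X sequentially "\<lambda>k. l + 1 / real (Suc k)"])
    show "(\<lambda>k. l + 1 / real (Suc k)) \<longlonglongrightarrow> l"
      using tendsto_add[OF tendsto_const[of l] LIMSEQ_Suc[OF lim_const_over_n[of 1]]] by simp
    show "\<forall>\<^sub>F k in sequentially. l \<le> X k" "\<forall>\<^sub>F k in sequentially. X k \<le> l + 1 / real (Suc k)"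
      using Xl X(2) by (auto intro!: always_eventually less_imp_le)
  qed simp
  have [measurable]: "bad (X k) \<in> sets borel" for k using open_bad[OF X0] by simp
  have [measurable]: "ball (0 :: real ^ 'n) 2 \<in> sets borel" by simp
  have "(\<lambda>k. LINT y|lborel. indicat_real (bad (X k)) y) \<longlonglongrightarrow> (LINT y :: real ^ 'n|lborel. 0)"
  proof (rule integral_dominated_convergence[where w = "indicator (ball 0 2)"])
    show "integrable lborel (indicat_real (ball (0 :: real ^ 'n) 2))"
      using emeasure_lborel_ball_finite[of "0 :: real ^ 'n" 2]
      by (intro integrable_real_indicator) auto
    show "AE y in lborel. norm (indicat_real (bad (X k)) y) \<le> indicat_real (ball 0 2) y" for k
      using \<Omega>_subset by (intro AE_I2) (auto simp: indicator_def bad_def)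
    \<comment> \<open>On the sphere of radius l the transform equals u and strictness is lost, but
      the sphere is a null set.\<close>
    show "AE y in lborel. (\<lambda>k. indicat_real (bad (X k)) y) \<longlonglongrightarrow> 0"
      using AE_not_sphere[of x l]
    proof eventually_elim
      case (elim y)
      have "\<forall>\<^sub>F k in sequentially. y \<notin> bad (X k)"
      proof (cases "l < norm (y - x) \<and> y \<in> \<Omega>")
        case True
        then have "\<forall>\<^sub>F k in sequentially. kelvin x (X k) y < u y"
          using kelvin_less[OF l bad_l] tendsto_kelvin[OF lim _ l, of y] X0(1)
          by (intro order_tendstoD(2)) (auto intro: less_imp_le)
        then show ?thesis by eventually_elim (auto simp: bad_def)
      next
        case False
        then have "y \<notin> bad (X k)" for k
          using elim Xl[of k] by (auto simp: bad_def)
        then show ?thesis by simp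
      qed
      then have "\<forall>\<^sub>F k in sequentially. indicat_real (bad (X k)) y = 0"
        by eventually_elim simp
      then show ?case by (rule tendsto_eventually)
    qed
  qed measurable
  then have meas: "(\<lambda>k. measure lborel (bad (X k))) \<longlonglongrightarrow> 0" by simp
  obtain \<delta> where \<delta>: "\<delta> > 0"
    "\<And>l. 0 < l \<Longrightarrow> l \<le> L \<Longrightarrow> measure lborel (bad l) < \<delta> \<Longrightarrow> bad l = {}"
    using bad_empty_if_small by blast
  obtain k where "measure lborel (bad (X k)) < \<delta>"
    using order_tendstoD(2)[OF meas \<delta>(1)] by (auto simp: eventually_sequentially)
  then have "bad (X k) = {}" using \<delta>(2) X0 by blast
  then show False using X(1)[of k] by (simp add: N_def)
qed

lemma kelvin_le:
  assumes "0 \<le> l" "l \<le> L" "l < norm (z - x)" "z \<in> \<Omega>"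
  shows "kelvin x l z \<le> u z"
  using bad_empty[OF assms(1,2)] assms by (force simp: bad_def)

end

section \<open>The upper bound\<close>

context integral_solution
begin

text \<open>With R = \<rho> e, the integral in the equation at z is at least (2^(-\<gamma>/2) M)^p
  |B_1| R^(n - \<gamma>), and n - \<gamma> = 2 \<sigma>. Since e^(2 \<sigma>) = M^(1 - p), the
  powers of M combine to M itself, and \<open>\<rho>_large\<close> makes the integral at least u(z),
  leaving no room for h(z) > 0.\<close>

lemma lower_bound_contradiction:
  fixes z :: "real ^ 'n" and M e \<rho> :: real
  assumes z: "z \<in> \<Omega>" and M: "M = u z" and e: "e = M powr (- (2 / \<gamma>))" and \<rho>: "\<rho> > 0"
    and \<rho>_large: "1 \<le> 2 powr (- (\<gamma> / 2 * p)) * measure lborel (ball (0 :: real ^ 'n) 1) * \<rho> powr (2 * \<sigma>)"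
    and sub: "ball z (\<rho> * e) \<subseteq> \<Omega>"
    and low: "\<And>y. y \<in> ball z (\<rho> * e) \<Longrightarrow> y \<noteq> z \<Longrightarrow> 2 powr (- (\<gamma> / 2)) * M \<le> u y"
  shows False
proof -
  let ?q = "\<gamma> / 2"
  let ?\<omega> = "measure lborel (ball (0 :: real ^ 'n) 1)"
  have M0: "M > 0" using M u_pos'[OF z] by simp
  then have e0: "e > 0" by (simp add: e)
  have q: "?q > 0" using gamma_pos by simp
  define R where "R = \<rho> * e"
  have R: "R > 0" using \<rho> e0 by (simp add: R_def)
  have [measurable]: "ball z R \<in> sets borel" by simp
  define m where "m = (2 powr (- ?q) * M) powr p * R powr (- \<gamma>)"
  have int: "integrable lborel (indicat_real (ball z R))"
    using emeasure_lborel_ball_finite[of z R] by (intro integrable_real_indicator) auto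
  have "(LINT y|lborel. m * indicator (ball z R) y) \<le> (LINT y|lborel. f y * norm (z - y) powr (- \<gamma>))"
  proof (rule integral_mono_AE)
    show "AE y in lborel. m * indicator (ball z R) y \<le> f y * norm (z - y) powr (- \<gamma>)"
      using AE_lborel_singleton[of z]
    proof eventually_elim
      case (elim y)
      show ?case
      proof (cases "y \<in> ball z R")
        case True
        then have y: "y \<in> \<Omega>" "2 powr (- ?q) * M \<le> u y"
          using sub low elim by (auto simp: R_def)
        have "(2 powr (- ?q) * M) powr p \<le> f y"
          unfolding f_\<Omega>[OF y(1)] using y(2) M0 p_gt_1 by (intro powr_mono2) auto
        moreover have "R powr (- \<gamma>) \<le> norm (z - y) powr (- \<gamma>)"
          using True elim gamma_pos by (intro powr_mono2') (auto simp: dist_norm)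
        ultimately show ?thesis
          using True f_nonneg[of y] by (auto simp: m_def intro!: mult_mono)
      qed (simp add: f_nonneg)
    qed
  qed (use int integrable_f_kernel[OF z] in auto)
  then have "m * measure lborel (ball z R) \<le> (LINT y|lborel. f y * norm (z - y) powr (- \<gamma>))"
    using int by simp
  also have "\<dots> < M"
    using integral_equation[OF z] h_pos[of z] z \<Omega>_subset M by force
  finally have less: "m * measure lborel (ball z R) < M" .
  have "measure lborel (ball z R) = ?\<omega> * R powr CARD('n)"
    using R by (simp add: content_ball powr_realpow)
  then have "m * measure lborel (ball z R) = (2 powr (- ?q) * M) powr p * ?\<omega> * (R powr (- \<gamma>) * R powr CARD('n))"
    by (simp add: m_def)
  also have "R powr (- \<gamma>) * R powr CARD('n) = R powr (2 * \<sigma>)"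
    by (simp add: powr_add[symmetric] \<gamma>_def)
  also have "R powr (2 * \<sigma>) = \<rho> powr (2 * \<sigma>) * e powr (2 * \<sigma>)"
    by (simp add: R_def powr_mult)
  also have "(2 powr (- ?q) * M) powr p = 2 powr (- (?q * p)) * M powr p"
    by (simp add: powr_mult powr_powr)
  also have "e powr (2 * \<sigma>) = M powr (1 - p)"
  proof -
    have "2 / \<gamma> * (2 * \<sigma>) = p - 1"
      using gamma_pos by (simp add: p_def field_simps) (simp add: \<gamma>_def)
    then have "- (2 / \<gamma>) * (2 * \<sigma>) = 1 - p" by linarith
    then show ?thesis unfolding e powr_powr by simp
  qed
  also have "2 powr (- (?q * p)) * M powr p * ?\<omega> * (\<rho> powr (2 * \<sigma>) * M powr (1 - p))
      = (2 powr (- (?q * p)) * ?\<omega> * \<rho> powr (2 * \<sigma>)) * (M powr p * M powr (1 - p))"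
    by (simp only: ac_simps)
  also have "M powr p * M powr (1 - p) = M"
    using M0 by (simp add: powr_add[symmetric])
  also have "(2 powr (- (?q * p)) * ?\<omega> * \<rho> powr (2 * \<sigma>)) * M \<ge> 1 * M"
    using \<rho>_large M0 by (intro mult_right_mono) auto
  finally show False using less by simp
qed

text \<open>Spheres centred at distance \<open>R\<close> from \<open>z\<close>, on the side opposite to \<open>y\<close>, and
  interchanging \<open>y\<close> and \<open>z\<close> compare \<open>u y\<close> with \<open>u z\<close>.\<close>

lemma kelvin_comparison:
  fixes y z :: "real ^ 'n"
  assumes R: "0 < R" and y: "y \<in> ball z R" "y \<noteq> z"
    and kelvin: "\<And>x l. dist x z = R \<Longrightarrow> 0 \<le> l \<Longrightarrow> l \<le> 2 * R \<Longrightarrow> l < norm (y - x) \<Longrightarrow> kelvin x l y \<le> u y"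
    and uz: "u z > 0"
  shows "2 powr (- (\<gamma> / 2)) * u z \<le> u y"
proof -
  define d where "d = norm (y - z)"
  have d: "0 < d" "d < R" using y by (auto simp: d_def dist_norm norm_minus_commute)
  define \<theta> where "\<theta> = (1 / d) *\<^sub>R (y - z)"
  have \<theta>: "norm \<theta> = 1" using d by (simp add: \<theta>_def flip: d_def)
  have yz: "y - z = d *\<^sub>R \<theta>" using d by (simp add: \<theta>_def)
  define x where "x = z - R *\<^sub>R \<theta>"
  have "y - x = (y - z) + R *\<^sub>R \<theta>" by (simp add: x_def)
  then have yx: "y - x = (R + d) *\<^sub>R \<theta>" unfolding yz by (simp add: scaleR_left_distrib)
  then have nyx: "norm (y - x) = R + d" using \<theta> R d by simp
  \<comment> \<open>Here l^2 is the product of the distances of z and y from x, so the inversion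
    interchanges the two points.\<close>
  define l where "l = sqrt (R * (R + d))"
  have l2: "l\<^sup>2 = R * (R + d)" using R d by (simp add: l_def)
  have l0: "0 \<le> l" using R d by (simp add: l_def)
  have "l\<^sup>2 < (R + d)\<^sup>2" unfolding l2 unfolding power2_eq_square
    by (rule mult_strict_right_mono) (use R d in auto)
  then have l1: "l < R + d" by (rule power2_less_imp_less) (use R d in simp)
  have inv: "inversion x l y = z"
  proof -
    have "inversion x l y = x + (l\<^sup>2 / (R + d)\<^sup>2 * (R + d)) *\<^sub>R \<theta>"
      unfolding inversion_def nyx unfolding yx by (simp add: power_divide)
    also have "l\<^sup>2 / (R + d)\<^sup>2 * (R + d) = R"
      unfolding l2 using R d by (simp add: power2_eq_square)
    finally show ?thesis by (simp add: x_def)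
  qed
  have ratio: "2 powr (- (\<gamma> / 2)) \<le> (l / (R + d)) powr \<gamma>"
  proof -
    \<comment> \<open>This uses d < R and is the origin of the factor 2^(-\<gamma>/2).\<close>
    have "(1 / 2 :: real) \<le> R / (R + d)" using R d by (simp add: field_simps)
    also have "R / (R + d) = (l / (R + d))\<^sup>2"
      unfolding power_divide l2 using R d by (simp add: power2_eq_square)
    finally have "(1 / 2) powr (\<gamma> / 2) \<le> ((l / (R + d))\<^sup>2) powr (\<gamma> / 2)"
      using gamma_pos by (intro powr_mono2) auto
    moreover have "((l / (R + d))\<^sup>2) powr (\<gamma> / 2) = (l / (R + d)) powr \<gamma>"
    proof -
      have "0 < l" using l2 R d by (simp add: l_def)
      then have "0 < l / (R + d)" using R d by simp
      then have sq: "(l / (R + d))\<^sup>2 = (l / (R + d)) powr 2" by (simp only: powr_numeral)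
      show ?thesis unfolding sq powr_powr by simp
    qed
    moreover have "(1 / 2) powr (\<gamma> / 2) = 2 powr (- (\<gamma> / 2))"
      by (simp add: powr_minus_divide powr_divide)
    ultimately show ?thesis by simp
  qed
  have "kelvin x l y \<le> u y"
  proof (rule kelvin[OF _ l0])
    show "dist x z = R" using R \<theta> by (simp add: x_def dist_norm)
    show "l \<le> 2 * R" using l1 d by linarith
    show "l < norm (y - x)" using l1 nyx by simp
  qed
  moreover have "kelvin x l y = (l / (R + d)) powr \<gamma> * u z"
    by (simp add: kelvin_def inv nyx)
  moreover have "2 powr (- (\<gamma> / 2)) * u z \<le> (l / (R + d)) powr \<gamma> * u z"
    using ratio uz by (intro mult_right_mono) auto
  ultimately show ?thesis by linarith
qed

text \<open>If e^(\<gamma>/2) u(z) is large, spheres of radius up to twice \<rho> M^(-2/\<gamma>)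
  can be moved inside \<open>ball z e\<close>, where u is at most a fixed multiple of M = u(z).
  \<open>kelvin_comparison\<close> then supplies the lower bound that
  \<open>lower_bound_contradiction\<close> refutes.\<close>

lemma no_concentration:
  obtains K where "K > 0"
    "\<And>z e. 0 < e \<Longrightarrow> e \<le> 1 / 4 \<Longrightarrow> norm z + e \<le> 3 / 2 \<Longrightarrow> ball z e \<subseteq> \<Omega> \<Longrightarrow>
       (\<And>y. y \<in> ball z e \<Longrightarrow> u y \<le> 2 powr (\<gamma> / 2) * u z) \<Longrightarrow> e powr (\<gamma> / 2) * u z \<le> K"
proof -
  define q where "q = \<gamma> / 2"
  have q: "q > 0" "2 * q = \<gamma>" using gamma_pos by (auto simp: q_def)
  obtain c where c: "c > 0" "\<And>z. z \<in> \<Omega> \<Longrightarrow> c \<le> u z" using u_lower_bound by blast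
  obtain r where r: "0 < r" "r < 1 / 8"
    "\<And>x l z. norm x \<le> 3 / 2 \<Longrightarrow> 0 < l \<Longrightarrow> l < norm (z - x) \<Longrightarrow> norm (z - x) < r \<Longrightarrow>
       (l / norm (z - x)) powr \<gamma> * h (inversion x l z) \<le> h z"
    using C1_kelvin_le[OF h_C1 h_pos q(1)] unfolding q(2) by blast
  define \<omega> where "\<omega> = measure lborel (ball (0 :: real ^ 'n) 1)"
  have \<omega>: "\<omega> > 0" using content_ball_pos[of 1 "0 :: real ^ 'n"] by (simp add: \<omega>_def)
  \<comment> \<open>Solves \<open>\<rho>_large\<close> with equality.\<close>
  define \<rho> where "\<rho> = (2 powr (q * p) / \<omega>) powr (1 / (2 * \<sigma>))"
  have \<rho>: "\<rho> > 0" using \<omega> by (simp add: \<rho>_def)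
  have "\<rho> powr (2 * \<sigma>) = 2 powr (q * p) / \<omega>"
    using \<omega> sigma_pos by (simp add: \<rho>_def powr_powr)
  then have \<rho>_large: "1 \<le> 2 powr (- (\<gamma> / 2 * p)) * \<omega> * \<rho> powr (2 * \<sigma>)"
    using \<omega> by (simp add: q_def powr_minus)
  define v where "v = (c powr p - (c / 2) powr p) * measure lborel (ball (0 :: real ^ 'n) (1 / 8))"
  have "v > 0"
    unfolding v_def using c p_gt_1 content_ball_pos[of "1/8" "0 :: real ^ 'n"]
    by (intro mult_pos_pos) (auto simp: powr_less_mono2)
  \<comment> \<open>The admissible size of L^\<gamma> S for both smallness conditions of
    \<open>moving_sphere\<close>; the 2 in the second denominator makes the annulus condition
    strict.\<close>
  define \<kappa> where "\<kappa> = min (c / 2 * r powr \<gamma>) (v / (2 * (12 * 16 powr q)))"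
  have \<kappa>: "\<kappa> > 0" using c r \<open>v > 0\<close> by (simp add: \<kappa>_def)
  have \<kappa>1: "\<kappa> \<le> c / 2 * r powr \<gamma>" by (simp add: \<kappa>_def)
  have \<kappa>2: "12 * 16 powr q * \<kappa> < v"
  proof -
    have "12 * 16 powr q * \<kappa> \<le> 12 * 16 powr q * (v / (2 * (12 * 16 powr q)))"
      by (intro mult_left_mono) (auto simp: \<kappa>_def)
    also have "\<dots> = v / 2" by simp
    finally show ?thesis using \<open>v > 0\<close> by simp
  qed
  \<comment> \<open>One summand for each requirement: 3 R < e, 2 R < r and (2 R)^\<gamma> 2^q M <=
    \<kappa>, where R = \<rho> M^(-2/\<gamma>).\<close>
  define K where "K = (3 * \<rho>) powr q + (2 * \<rho>) powr q / r powr q + (2 * \<rho>) powr \<gamma> * 2 powr q / \<kappa>"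
  have K_parts: "0 < (3 * \<rho>) powr q" "0 < (2 * \<rho>) powr q / r powr q" "0 < (2 * \<rho>) powr \<gamma> * 2 powr q / \<kappa>"
    using \<rho> r \<kappa> by auto
  show ?thesis
  proof (rule that[of K])
    show "K > 0" unfolding K_def by (intro add_pos_pos K_parts)
    fix z e
    assume e: "0 < e" "e \<le> 1 / 4" and ze: "norm z + e \<le> 3 / 2" and sub: "ball z e \<subseteq> \<Omega>"
      and dbl: "\<And>y. y \<in> ball z e \<Longrightarrow> u y \<le> 2 powr (\<gamma> / 2) * u z"
    show "e powr (\<gamma> / 2) * u z \<le> K"
    proof (rule ccontr)
      define M where "M = u z"
      assume "\<not> e powr (\<gamma> / 2) * u z \<le> K"
      then have big: "K < e powr q * M" by (simp add: q_def M_def)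
      have z: "z \<in> \<Omega>" using sub e by auto
      have M0: "M > 0" using u_pos'[OF z] by (simp add: M_def)
      have "e powr q \<le> 1" using powr_mono2[of q e 1] e q by simp
      then have "e powr q * M \<le> M" using M0 by simp
      then have KM: "K < M" using big by simp
      define \<epsilon> where "\<epsilon> = M powr (- (2 / \<gamma>))"
      have \<epsilon>0: "\<epsilon> > 0" using M0 by (simp add: \<epsilon>_def)
      have \<epsilon>q: "\<epsilon> powr q = 1 / M"
      proof -
        have "- (2 / \<gamma>) * q = - 1" using gamma_pos by (simp add: q_def)
        then show ?thesis unfolding \<epsilon>_def powr_powr using M0 by (simp add: powr_minus_divide)
      qed
      have scale: "(a * \<epsilon>) powr q = a powr q / M" for a
        by (simp add: powr_mult \<epsilon>q)
      have less: "a < b" if "a powr q < b powr q" "0 \<le> b" for a b :: real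
      proof (rule ccontr)
        assume "\<not> a < b"
        then have "b powr q \<le> a powr q" using q \<open>0 \<le> b\<close> by (intro powr_mono2) auto
        then show False using that by simp
      qed
      have 1: "3 * \<rho> * \<epsilon> < e"
      proof (rule less)
        have "(3 * \<rho>) powr q < e powr q * M" using big K_parts unfolding K_def by linarith
        then show "(3 * \<rho> * \<epsilon>) powr q < e powr q" unfolding scale using M0 by (simp add: divide_less_eq)
      qed (use e in simp)
      have 2: "2 * \<rho> * \<epsilon> < r"
      proof (rule less)
        have "(2 * \<rho>) powr q / r powr q < M" using KM K_parts unfolding K_def by linarith
        then show "(2 * \<rho> * \<epsilon>) powr q < r powr q" unfolding scale using M0 r by (simp add: pos_divide_less_eq mult.commute)
      qed (use r in simp)
      \<comment> \<open>As \<epsilon>^\<gamma> = M^(-2), the left-hand side is a constant divided by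
        M.\<close>
      have 3: "(2 * \<rho> * \<epsilon>) powr \<gamma> * (2 powr q * M) \<le> \<kappa>"
      proof -
        have "(2 * \<rho> * \<epsilon>) powr \<gamma> = (2 * \<rho>) powr \<gamma> * (\<epsilon> powr q * \<epsilon> powr q)"
          by (simp add: powr_mult powr_add[symmetric] q_def)
        then have "(2 * \<rho> * \<epsilon>) powr \<gamma> * (2 powr q * M) = (2 * \<rho>) powr \<gamma> * 2 powr q / M"
          using M0 by (simp add: \<epsilon>q)
        also have "\<dots> \<le> \<kappa>"
        proof -
          have "(2 * \<rho>) powr \<gamma> * 2 powr q / \<kappa> < M" using KM K_parts unfolding K_def by linarith
          then show ?thesis using M0 \<kappa> by (simp add: pos_divide_less_eq pos_divide_le_eq mult.commute)
        qed
        finally show ?thesis .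
      qed
      define R where "R = \<rho> * \<epsilon>"
      have R: "0 < R" "3 * R < e" "2 * R < r" using \<rho> \<epsilon>0 1 2 by (auto simp: R_def)
      have kelvin: "kelvin x l y \<le> u y"
        if "dist x z = R" "0 \<le> l" "l \<le> 2 * R" "l < norm (y - x)" "y \<in> \<Omega>" for x l y
      proof -
        \<comment> \<open>The spheres stay within 3 R of z, where u is at most
          \<open>2 powr q * M\<close>.\<close>
        have cb: "cball x (2 * R) \<subseteq> ball z e"
        proof
          fix y assume "y \<in> cball x (2 * R)"
          then show "y \<in> ball z e"
            using that(1) R dist_triangle[of z y x] by (simp add: dist_commute)
        qed
        interpret moving_sphere \<sigma> \<Sigma> h u x "2 * R" "2 powr q * M" c r
        proof
          show "norm x \<le> 3 / 2"
            using that(1) R ze norm_triangle_ineq2[of x z] by (simp add: dist_norm)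
          show "cball x (2 * R) \<subseteq> \<Omega>" using cb sub by blast
          show "u y \<le> 2 powr q * M" if "y \<in> cball x (2 * R)" for y
            using dbl cb that by (auto simp: M_def q_def)
          show "(2 * R) powr \<gamma> * (2 powr q * M) \<le> c / 2 * r powr \<gamma>"
            using 3 \<kappa>1 by (simp add: R_def mult.assoc)
          have "12 * 16 powr q * ((2 * R) powr \<gamma> * (2 powr q * M)) \<le> 12 * 16 powr q * \<kappa>"
            using 3 by (intro mult_left_mono) (auto simp: R_def mult.assoc)
          then show "12 * 16 powr (\<gamma> / 2) * ((2 * R) powr \<gamma> * (2 powr q * M))
             < (c powr p - (c / 2) powr p) * measure lborel (ball (0 :: real ^ 'n) (1 / 8))"
            using \<kappa>2 unfolding v_def q_def by linarith
          show "(l / norm (z - x)) powr \<gamma> * h (inversion x l z) \<le> h z"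
            if "0 < l" "l < norm (z - x)" "norm (z - x) < r" for l z
            using r(3) that \<open>norm x \<le> 3 / 2\<close> by blast
        qed (use R r(1,2) c in auto)
        show ?thesis using kelvin_le that by blast
      qed
      have subR: "ball z R \<subseteq> \<Omega>" using sub R subset_ball[of R e z] by auto
      have low: "2 powr (- (\<gamma> / 2)) * M \<le> u y" if "y \<in> ball z R" "y \<noteq> z" for y
        unfolding M_def using R(1) that
      proof (rule kelvin_comparison)
        show "kelvin x l y \<le> u y" if "dist x z = R" "0 \<le> l" "l \<le> 2 * R" "l < norm (y - x)" for x l
          using kelvin[OF that] subR \<open>y \<in> ball z R\<close> by blast
      qed (use M0 in \<open>simp add: M_def\<close>)
      show False
        by (rule lower_bound_contradiction[OF z M_def \<epsilon>_def \<rho> \<rho>_large[unfolded \<omega>_def]])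
           (use subR low in \<open>auto simp: R_def\<close>)
    qed
  qed
qed

text \<open>Doubling in one step: maximize (s - |y - x|)^q u(y) over a closed ball around x that
  avoids \<Sigma>. If 2 e is the remaining distance at the maximum point z, the weight on
  \<open>ball z e\<close> is at least e^q, against (2 e)^q at z. So u <= 2^q u(z) there, and
  \<open>no_concentration\<close> applies.\<close>

lemma upper_bound:
  assumes "\<Sigma> \<noteq> {}"
  obtains C where "C > 0" "\<And>x. x \<in> ball 0 1 - \<Sigma> \<Longrightarrow> u x \<le> C * infdist x \<Sigma> powr (- (\<gamma> / 2))"
proof -
  define q where "q = \<gamma> / 2"
  have q: "q > 0" using gamma_pos by (simp add: q_def)
  obtain K where K: "K > 0"
    "\<And>z e. 0 < e \<Longrightarrow> e \<le> 1 / 4 \<Longrightarrow> norm z + e \<le> 3 / 2 \<Longrightarrow> ball z e \<subseteq> \<Omega> \<Longrightarrow>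
       (\<And>y. y \<in> ball z e \<Longrightarrow> u y \<le> 2 powr q * u z) \<Longrightarrow> e powr q * u z \<le> K"
    unfolding q_def using no_concentration by blast
  \<comment> \<open>On B_1 the distance d to \<Sigma> is at most \<open>D\<close>, so s = a d is at
    most 1/4; the fixed proportion a turns a bound in s into one in d.\<close>
  define D where "D = infdist 0 \<Sigma> + 1"
  have D: "D \<ge> 1" using infdist_nonneg[of 0 \<Sigma>] by (simp add: D_def)
  define a where "a = 1 / (4 * D)"
  have a: "0 < a" "a \<le> 1 / 4" using D by (auto simp: a_def divide_le_eq)
  show ?thesis
  proof (rule that[of "2 powr q * K * a powr (- q)"])
    show "2 powr q * K * a powr (- q) > 0" using K a by simp
    fix x assume x: "x \<in> ball 0 1 - \<Sigma>"
    define d where "d = infdist x \<Sigma>"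
    have d: "d > 0"
      using x assms closed_sing infdist_pos_not_in_closed[of \<Sigma> x] by (simp add: d_def)
    have "d \<le> D"
      using infdist_triangle[of x \<Sigma> 0] x by (simp add: d_def D_def)
    define s where "s = a * d"
    have "s \<le> 1 / 4 * d" unfolding s_def using a d by (intro mult_right_mono) auto
    moreover have "s \<le> a * D" unfolding s_def using a \<open>d \<le> D\<close> by (intro mult_left_mono) auto
    ultimately have s: "0 < s" "s < d" "s \<le> 1 / 4"
      using a d D by (auto simp: s_def a_def)
    have sub: "cball x s \<subseteq> \<Omega>"
    proof
      fix y assume y: "y \<in> cball x s"
      have "y \<notin> \<Sigma>"
        using infdist_le[of y \<Sigma> x] y s by (auto simp: d_def)
      moreover have "norm y < 2"
        using y s x norm_triangle_ineq2[of y x] by (simp add: dist_norm norm_minus_commute)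
      ultimately show "y \<in> \<Omega>" by (simp add: \<Omega>_def)
    qed
    define g where "g y = (s - norm (y - x)) powr q * u y" for y
    have "continuous_on (cball x s) g"
      unfolding g_def using q
      by (intro continuous_intros continuous_on_powr' continuous_on_subset[OF continuous_on_u sub])
         (auto simp: dist_norm norm_minus_commute)
    then obtain z where z: "z \<in> cball x s" "\<And>y. y \<in> cball x s \<Longrightarrow> g y \<le> g z"
      using continuous_attains_sup[of "cball x s" g] s by fastforce
    define e where "e = (s - norm (z - x)) / 2"
    have gx: "g x = s powr q * u x" by (simp add: g_def)
    have "g x > 0" unfolding gx using s sub by (intro mult_pos_pos u_pos') auto
    then have "g z > 0" using z(2)[of x] s by auto
    then have "s - norm (z - x) \<noteq> 0" by (auto simp: g_def)
    moreover have "norm (z - x) \<le> s" using z(1) by (simp add: dist_norm norm_minus_commute)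
    ultimately have e: "0 < e" "e \<le> s / 2" by (auto simp: e_def)
    have gz: "g z = 2 powr q * (e powr q * u z)"
    proof -
      have "s - norm (z - x) = 2 * e" by (simp add: e_def)
      then show ?thesis by (simp add: g_def powr_mult)
    qed
    have near: "y \<in> cball x s \<and> e \<le> s - norm (y - x)" if "y \<in> ball z e" for y
    proof -
      have "norm (y - x) \<le> norm (y - z) + norm (z - x)"
        using norm_triangle_ineq[of "y - z" "z - x"] by simp
      moreover have "norm (y - z) < e" using that by (simp add: dist_norm norm_minus_commute)
      ultimately have "norm (y - x) \<le> s - e" by (simp add: e_def field_simps)
      then show ?thesis using e by (simp add: dist_norm norm_minus_commute)
    qed
    have "e powr q * u z \<le> K"
    proof (rule K(2))
      show "norm z + e \<le> 3 / 2"
        using z(1) e s x norm_triangle_ineq2[of z x] by (simp add: dist_norm norm_minus_commute)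
      show "ball z e \<subseteq> \<Omega>" using near sub by blast
      fix y assume y: "y \<in> ball z e"
      have "e powr q * u y \<le> (s - norm (y - x)) powr q * u y"
        using near[OF y] e q u_pos'[of y] sub by (intro mult_right_mono powr_mono2) (auto intro: less_imp_le)
      also have "\<dots> \<le> g z" using z(2) near[OF y] by (simp add: g_def)
      also have "\<dots> = e powr q * (2 powr q * u z)" by (simp add: gz)
      finally show "u y \<le> 2 powr q * u z" using e by simp
    qed (use e s in auto)
    then have "s powr q * u x \<le> 2 powr q * K"
    proof -
      have "s powr q * u x \<le> 2 powr q * (e powr q * u z)"
        using z(2)[of x] s unfolding gx gz by simp
      also have "\<dots> \<le> 2 powr q * K"
        using \<open>e powr q * u z \<le> K\<close> by (intro mult_left_mono) auto
      finally show ?thesis .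
    qed
    then have "u x \<le> 2 powr q * K * s powr (- q)"
      using s by (simp add: powr_minus field_simps)
    also have "s powr (- q) = a powr (- q) * d powr (- q)"
      by (simp add: s_def powr_mult)
    finally show "u x \<le> 2 powr q * K * a powr (- q) * infdist x \<Sigma> powr (- (\<gamma> / 2))"
      by (simp add: d_def q_def mult_ac)
  qed
qed

end

theorem theorem1p5:
  fixes \<sigma> :: real
    and \<Sigma> :: "(real ^ 'n) set"
    and h u :: "real ^ 'n \<Rightarrow> real"
  assumes "0 < \<sigma>" and "\<sigma> < real CARD('n) / 2"
    and "\<Sigma> \<noteq> {}" and "closed \<Sigma>" and "\<Sigma> \<in> null_sets lebesgue"
    and "C1_on (ball 0 2) h" and "\<And>x. x \<in> ball 0 2 \<Longrightarrow> h x > 0"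
    and "Lp_on ((real CARD('n) + 2 * \<sigma>) / (real CARD('n) - 2 * \<sigma>)) (ball 0 2) u"
    and "continuous_on (ball 0 2 - \<Sigma>) u" and "\<And>x. x \<in> ball 0 2 - \<Sigma> \<Longrightarrow> u x > 0"
    and "solves_integral_eq \<sigma> h \<Sigma> u"
  shows "\<exists>C>0. \<forall>x \<in> ball 0 1 - \<Sigma>.
           u x \<le> C * infdist x \<Sigma> powr (- ((real CARD('n) - 2 * \<sigma>) / 2))"
proof -
  interpret integral_solution \<sigma> \<Sigma> h u
    by unfold_locales (use assms in auto)
  obtain C where "C > 0" "\<And>x. x \<in> ball 0 1 - \<Sigma> \<Longrightarrow> u x \<le> C * infdist x \<Sigma> powr (- (\<gamma> / 2))"
    using upper_bound[OF \<open>\<Sigma> \<noteq> {}\<close>] by blast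
  then show ?thesis unfolding \<gamma>_def by blast
qed

end
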